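(* Let $0\le p_0<q_0\le1$ and $4 \delta < \rho < \frac{1}{2}$. There is a $\rho$-replicable algorithm solving the $N$-coin problem (with parameters $p_0,q_0,\delta$) with expected coordinate sample complexity (and running time) $O\left(\frac{N^2 q_0 \log(N/\delta)}{(q_0 - p_0)^2 \rho}\right)$ and worst-case coordinate sample complexity (and running time) $O\left(\frac{N^2 q_0 \log(N/\delta)}{(q_0 - p_0)^2 \rho^2}\right)$.
   Context: $N$-coin problem (parameters $p_0<q_0$, $\delta>0$): given sample access to $N$ (possibly correlated) coins with unknown biases $p_1,\dots,p_N\in[0,1]$, output a set $\mathcal{O}\subset[N]$ such that $\Pr\left(\exists i:\ (p_i\le p_0 \text{ and } i\in\mathcal{O})\text{ or }(p_i\ge q_0\text{ and }i\notin\mathcal{O})\right)<\delta$. A coordinate sample is a flip of one coin chosen (adaptively) by the algorithm; the coordinate sample complexity is the total number of such flips (expected, over samples and internal randomness, or worst-case). Replicability: an algorithm $\mathcal{A}$ with internal randomness $r$ is $\rho$-replicable if for all input distributions $\mathcal{D}$, $\Pr_{r,S,S'}(\mathcal{A}(S;r)=\mathcal{A}(S';r))\ge 1-\rho$, where $S,S'$ are independent sets of i.i.d. samples from $\mathcal{D}$ and $r$ is shared between the two runs. $O(\cdot)$ hides an absolute constant. *)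

theory Defs
  imports "HOL-Probability.Probability"
begin

section \<open>Samples, replicability and the coin problem\<close>

text \<open>
  The coins are numbered \<open>1, \<dots>, N\<close>.  A joint toss of all coins is a function
  \<open>nat \<Rightarrow> bool\<close> (\<open>True\<close> is heads), of which only the values on \<open>{1..N}\<close> are ever used; an
  arbitrary, possibly correlated distribution on the joint tosses is a \<open>(nat \<Rightarrow> bool) pmf\<close>.
  A sample set is an infinite i.i.d. sequence of joint tosses, and the internal randomness is an
  infinite sequence of fair bits; an algorithm only looks at finitely many entries of both.
\<close>

type_synonym samples = "nat \<Rightarrow> nat \<Rightarrow> bool"
type_synonym bits = "nat \<Rightarrow> bool"

definition bias :: "(nat \<Rightarrow> bool) pmf \<Rightarrow> nat \<Rightarrow> real" where
  "bias D i = measure_pmf.prob D {x. x i}"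

definition iid_samples :: "(nat \<Rightarrow> bool) pmf \<Rightarrow> samples measure" where
  "iid_samples D = (\<Pi>\<^sub>M k\<in>UNIV. measure_pmf D)"

definition random_bits :: "bits measure" where
  "random_bits = (\<Pi>\<^sub>M k\<in>UNIV. measure_pmf (bernoulli_pmf (1/2)))"

text \<open>
  The following two notions are stated for the input-output function \<open>A S r\<close> of an algorithm.
  If \<open>A\<close> is computed by a program that always halts, then each output depends on finitely many
  bits of \<open>S\<close> and \<open>r\<close> only, so that all events below are measurable.
\<close>

definition replicable :: "real \<Rightarrow> (samples \<Rightarrow> bits \<Rightarrow> 'o) \<Rightarrow> bool" where
  "replicable \<rho> A \<longleftrightarrow>
     (\<forall>D. measure (random_bits \<Otimes>\<^sub>M (iid_samples D \<Otimes>\<^sub>M iid_samples D))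
            {(r, S, S'). A S r = A S' r} \<ge> 1 - \<rho>)"

definition solves_coin_problem ::
    "nat \<Rightarrow> real \<Rightarrow> real \<Rightarrow> real \<Rightarrow> (samples \<Rightarrow> bits \<Rightarrow> nat set) \<Rightarrow> bool" where
  "solves_coin_problem N p\<^sub>0 q\<^sub>0 \<delta> A \<longleftrightarrow>
     (\<forall>S r. A S r \<subseteq> {1..N}) \<and>
     (\<forall>D. measure (random_bits \<Otimes>\<^sub>M iid_samples D)
            {(r, S). \<exists>i\<in>{1..N}. (bias D i \<le> p\<^sub>0 \<and> i \<in> A S r) \<or> (bias D i \<ge> q\<^sub>0 \<and> i \<notin> A S r)} < \<delta>)"


section \<open>The model of computation\<close>

text \<open>
  Running time is measured on a unit-cost real RAM (without rounding) that has, in addition to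
  arithmetic, comparison and indirect addressing, one instruction each for flipping a coin, for
  drawing an internal random bit, and for putting a coin into the output set.  The memory cells
  \<open>M 0, M 1, \<dots>\<close> hold real numbers.  The instructions mean

    \<^item> \<open>Arith f x y z\<close>: \<open>M x := M y f M z\<close>
    \<^item> \<open>Load x y\<close>: \<open>M x := M (M y)\<close>, and \<open>Store x y\<close>: \<open>M (M x) := M y\<close>
    \<^item> \<open>Flip x y\<close>: flip the coin number \<open>M y\<close> and set \<open>M x\<close> to 1 (heads) or 0 (tails)
    \<^item> \<open>Toss x\<close>: set \<open>M x\<close> to an internal random bit
    \<^item> \<open>Accept x\<close>: put the coin number \<open>M x\<close> into the output set
    \<^item> \<open>If x y c d\<close> and \<open>While x y c\<close> use the test \<open>M x < M y\<close>.

  Programs contain integer constants only.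
\<close>

datatype arith = Add | Sub | Mul | Div

fun arith_fun :: "arith \<Rightarrow> real \<Rightarrow> real \<Rightarrow> real" where
  "arith_fun Add a b = a + b"
| "arith_fun Sub a b = a - b"
| "arith_fun Mul a b = a * b"
| "arith_fun Div a b = a / b"

datatype program =
    Skip
  | Const nat int
  | Arith arith nat nat nat
  | Load nat nat
  | Store nat nat
  | Flip nat nat
  | Toss nat
  | Accept nat
  | Seq program program
  | If nat nat program program
  | While nat nat program

text \<open>\<open>flips s i\<close> is the number of flips of coin \<open>i\<close> so far, \<open>tosses s\<close> the number of internal
  random bits drawn so far.\<close>

record state =
  mem :: "nat \<Rightarrow> real"
  flips :: "nat \<Rightarrow> nat"
  tosses :: nat
  accepted :: "nat set"

text \<open>
  \<open>exec N S r c s t s'\<close>: on samples \<open>S\<close> and random bits \<open>r\<close>, the program \<open>c\<close> started in state \<open>s\<close>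
  halts after \<open>t\<close> steps in state \<open>s'\<close>.  The \<open>k\<close>-th flip of coin \<open>i\<close> shows the \<open>i\<close>-th coordinate of
  the \<open>k\<close>-th joint toss.  Thus repeated flips of one coin are independent, whereas flips of
  different coins may be correlated as prescribed by the joint distribution; flips that are
  independent across coins arise as the special case of a product distribution.  A run gets stuck
  at an address that is not a natural number, and at a coin number that is not in \<open>{1..N}\<close>.
\<close>

inductive exec ::
    "nat \<Rightarrow> samples \<Rightarrow> bits \<Rightarrow> program \<Rightarrow> state \<Rightarrow> nat \<Rightarrow> state \<Rightarrow> bool"
  for N :: nat and S :: samples and r :: bits where
  Skip: "exec N S r Skip s 1 s"
| Const: "exec N S r (Const x c) s 1 (s\<lparr>mem := (mem s)(x := of_int c)\<rparr>)"
| Arith: "exec N S r (Arith f x y z) s 1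
            (s\<lparr>mem := (mem s)(x := arith_fun f (mem s y) (mem s z))\<rparr>)"
| Load: "mem s y = of_nat a \<Longrightarrow>
         exec N S r (Load x y) s 1 (s\<lparr>mem := (mem s)(x := mem s a)\<rparr>)"
| Store: "mem s x = of_nat a \<Longrightarrow>
         exec N S r (Store x y) s 1 (s\<lparr>mem := (mem s)(a := mem s y)\<rparr>)"
| Flip: "mem s y = of_nat i \<Longrightarrow> i \<in> {1..N} \<Longrightarrow>
         exec N S r (Flip x y) s 1
           (s\<lparr>mem := (mem s)(x := of_bool (S (flips s i) i)),
              flips := (flips s)(i := Suc (flips s i))\<rparr>)"
| Toss: "exec N S r (Toss x) s 1
           (s\<lparr>mem := (mem s)(x := of_bool (r (tosses s))), tosses := Suc (tosses s)\<rparr>)"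
| Accept: "mem s x = of_nat i \<Longrightarrow> i \<in> {1..N} \<Longrightarrow>
         exec N S r (Accept x) s 1 (s\<lparr>accepted := insert i (accepted s)\<rparr>)"
| Seq: "exec N S r c s t s' \<Longrightarrow> exec N S r d s' t' s'' \<Longrightarrow>
        exec N S r (Seq c d) s (t + t') s''"
| If_True: "mem s x < mem s y \<Longrightarrow> exec N S r c s t s' \<Longrightarrow>
        exec N S r (If x y c d) s (Suc t) s'"
| If_False: "\<not> mem s x < mem s y \<Longrightarrow> exec N S r d s t s' \<Longrightarrow>
        exec N S r (If x y c d) s (Suc t) s'"
| While_False: "\<not> mem s x < mem s y \<Longrightarrow> exec N S r (While x y c) s 1 s"
| While_True: "mem s x < mem s y \<Longrightarrow> exec N S r c s t s' \<Longrightarrow>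
        exec N S r (While x y c) s' t' s'' \<Longrightarrow>
        exec N S r (While x y c) s (Suc (t + t')) s''"

inductive_cases exec_elims:
  "exec N S r Skip s t s'"
  "exec N S r (Const x c) s t s'"
  "exec N S r (Arith f x y z) s t s'"
  "exec N S r (Load x y) s t s'"
  "exec N S r (Store x y) s t s'"
  "exec N S r (Flip x y) s t s'"
  "exec N S r (Toss x) s t s'"
  "exec N S r (Accept x) s t s'"
  "exec N S r (Seq c d) s t s'"
  "exec N S r (If x y c d) s t s'"

inductive_cases exec_While_elim: "exec N S r (While x y c) s t s'"

lemma exec_deterministic:
  assumes "exec N S r c s t s'" and "exec N S r c s u s''"
  shows "t = u \<and> s' = s''"
  using assms
proof (induction arbitrary: u s'' rule: exec.induct)
  case (Seq c s t s' d t' s2)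
  from Seq.prems obtain v w s3 where "exec N S r c s v s3" "exec N S r d s3 w s''" "u = v + w"
    by (elim exec_elims)
  with Seq.IH show ?case by metis
next
  case (While_False s x y c)
  from While_False.prems While_False.hyps show ?case
    by (auto elim: exec_While_elim)
next
  case (While_True s x y c t s' t' s2)
  from While_True.prems While_True.hyps(1) obtain v w s3 where
    "exec N S r c s v s3" "exec N S r (While x y c) s3 w s''" "u = Suc (v + w)"
    by (meson exec_While_elim)
  with While_True.IH show ?case by metis
next
  case (If_True s x y c t s' d)
  from If_True.prems If_True.hyps(1) obtain v where "exec N S r c s v s''" "u = Suc v"
    by (meson exec_elims(10))
  with If_True.IH show ?case by metis
next
  case (If_False s x y d t s' c)
  from If_False.prems If_False.hyps(1) obtain v where "exec N S r d s v s''" "u = Suc v"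
    by (meson exec_elims(10))
  with If_False.IH show ?case by metis
qed (auto elim!: exec_elims(1-8))

text \<open>The parameters of the coin problem are part of the input, in the cells \<open>0, \<dots>, 4\<close>.\<close>

definition initial_state :: "nat \<Rightarrow> real \<Rightarrow> real \<Rightarrow> real \<Rightarrow> real \<Rightarrow> state" where
  "initial_state N p\<^sub>0 q\<^sub>0 \<delta> \<rho> =
     \<lparr>mem = (\<lambda>_. 0)(0 := of_nat N, 1 := p\<^sub>0, 2 := q\<^sub>0, 3 := \<delta>, 4 := \<rho>),
      flips = (\<lambda>_. 0), tosses = 0, accepted = {}\<rparr>"

definition always_halts :: "program \<Rightarrow> nat \<Rightarrow> state \<Rightarrow> bool" where
  "always_halts P N s \<longleftrightarrow> (\<forall>S r. \<exists>t s'. exec N S r P s t s')"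

definition running_time :: "program \<Rightarrow> nat \<Rightarrow> state \<Rightarrow> samples \<Rightarrow> bits \<Rightarrow> nat" where
  "running_time P N s S r = (THE t. \<exists>s'. exec N S r P s t s')"

definition final_state :: "program \<Rightarrow> nat \<Rightarrow> state \<Rightarrow> samples \<Rightarrow> bits \<Rightarrow> state" where
  "final_state P N s S r = (THE s'. \<exists>t. exec N S r P s t s')"

definition coin_output :: "program \<Rightarrow> nat \<Rightarrow> state \<Rightarrow> samples \<Rightarrow> bits \<Rightarrow> nat set" where
  "coin_output P N s S r = accepted (final_state P N s S r)"

definition coordinate_samples :: "program \<Rightarrow> nat \<Rightarrow> state \<Rightarrow> samples \<Rightarrow> bits \<Rightarrow> nat" where
  "coordinate_samples P N s S r = (\<Sum>i\<in>{1..N}. flips (final_state P N s S r) i)"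

definition expected_cost_le :: "(samples \<Rightarrow> bits \<Rightarrow> nat) \<Rightarrow> real \<Rightarrow> bool" where
  "expected_cost_le f b \<longleftrightarrow>
     (\<forall>D. (\<integral>\<^sup>+ (r, S). of_nat (f S r) \<partial>(random_bits \<Otimes>\<^sub>M iid_samples D)) \<le> ennreal b)"

definition worst_case_cost_le :: "(samples \<Rightarrow> bits \<Rightarrow> nat) \<Rightarrow> real \<Rightarrow> bool" where
  "worst_case_cost_le f b \<longleftrightarrow> (\<forall>S r. real (f S r) \<le> b)"

end

theory Submission
  imports Defs
begin

text \<open>
  All coins are compared with one common random threshold \<open>\<theta>\<close> from the middle half of
  \<open>[p\<^sub>0, q\<^sub>0]\<close>.  Phase \<open>k\<close> brings the number of flips of a coin to \<open>n\<^sub>0 4\<^sup>k\<close>, which estimates its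
  bias (clipped at \<open>q\<^sub>0\<close>) up to \<open>\<Delta>\<^sub>k = (q\<^sub>0 - p\<^sub>0) / (8 * 2\<^sup>k)\<close>; a coin is settled as soon as the estimate
  is at distance at least \<open>\<Delta>\<^sub>k\<close> from \<open>\<theta>\<close>.  No coin enters a further phase once the flips of all coins
  reach the budget \<open>n\<^sub>0 4\<^sup>K\<close>, where \<open>2\<^sup>K\<close> is of order \<open>N / \<rho>\<close>.  By Chernoff bounds all estimates are
  accurate with probability more than \<open>1 - \<delta>\<close>; then every answer is correct, and the number of flips
  is bounded by a function of \<open>\<theta>\<close> alone.  A coin needs phase \<open>k + 1\<close> only if its bias is within
  \<open>2 \<Delta>\<^sub>k\<close> of \<open>\<theta>\<close>, which has probability \<open>O(2\<^sup>-\<^sup>k)\<close>, so this function has expectation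
  \<open>O(N n\<^sub>0 2\<^sup>K)\<close>.  By Markov's inequality the budget is exhausted with probability at most \<open>\<rho> / 4\<close>, and
  otherwise the output is determined by \<open>\<theta>\<close> and the biases.
\<close>

section \<open>Weakest preconditions\<close>

text \<open>Total correctness: halting is part of the claim, and \<open>Q\<close> also sees the
  number of steps. Since runs are deterministic by \<open>exec_deterministic\<close>, one witnessing
  run says everything about the program.\<close>

definition wp :: "nat \<Rightarrow> samples \<Rightarrow> bits \<Rightarrow> program \<Rightarrow> (nat \<Rightarrow> state \<Rightarrow> bool) \<Rightarrow> state \<Rightarrow> bool" where
  "wp N S r c Q s \<longleftrightarrow> (\<exists>t s'. exec N S r c s t s' \<and> Q t s')"

lemma wp_Skip [simp]: "wp N S r Skip Q s \<longleftrightarrow> Q 1 s"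
  unfolding wp_def by (metis exec.Skip exec_elims(1))

lemma wp_Const [simp]:
  "wp N S r (Const x c) Q s \<longleftrightarrow> Q 1 (s\<lparr>mem := (mem s)(x := of_int c)\<rparr>)"
  unfolding wp_def by (metis exec.Const exec_elims(2))

lemma wp_Arith [simp]:
  "wp N S r (Arith f x y z) Q s \<longleftrightarrow>
     Q 1 (s\<lparr>mem := (mem s)(x := arith_fun f (mem s y) (mem s z))\<rparr>)"
  unfolding wp_def by (metis exec.Arith exec_elims(3))

lemma wp_Toss [simp]:
  "wp N S r (Toss x) Q s \<longleftrightarrow>
     Q 1 (s\<lparr>mem := (mem s)(x := of_bool (r (tosses s))), tosses := Suc (tosses s)\<rparr>)"
  unfolding wp_def by (metis exec.Toss exec_elims(7))

lemma wp_Flip: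
  assumes "mem s y = of_nat i" "i \<in> {1..N}"
    and "Q 1 (s\<lparr>mem := (mem s)(x := of_bool (S (flips s i) i)),
              flips := (flips s)(i := Suc (flips s i))\<rparr>)"
  shows "wp N S r (Flip x y) Q s"
  unfolding wp_def using exec.Flip[OF assms(1,2)] assms(3) by blast

lemma wp_Accept:
  assumes "mem s x = of_nat i" "i \<in> {1..N}"
    and "Q 1 (s\<lparr>accepted := insert i (accepted s)\<rparr>)"
  shows "wp N S r (Accept x) Q s"
  unfolding wp_def using exec.Accept[OF assms(1,2)] assms(3) by blast

lemma wp_Seq [simp]:
  "wp N S r (Seq c d) Q s \<longleftrightarrow> wp N S r c (\<lambda>t. wp N S r d (\<lambda>t'. Q (t + t'))) s"
  unfolding wp_def by (blast intro: exec.Seq elim: exec_elims(9))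

lemma wp_If [simp]:
  "wp N S r (If x y c d) Q s \<longleftrightarrow>
     (if mem s x < mem s y then wp N S r c (\<lambda>t. Q (Suc t)) s else wp N S r d (\<lambda>t. Q (Suc t)) s)"
  unfolding wp_def by (auto intro: exec.If_True exec.If_False elim!: exec_elims(10))

text \<open>The invariant carries the elapsed time and a variant that decreases in each round.\<close>

lemma wp_While:
  fixes I :: "nat \<Rightarrow> nat \<Rightarrow> state \<Rightarrow> bool"
  assumes body: "\<And>v t s. I v t s \<Longrightarrow> mem s x < mem s y \<Longrightarrow>
      wp N S r c (\<lambda>t' s'. \<exists>v'<v. I v' (Suc (t + t')) s') s"
    and exit: "\<And>v t s. I v t s \<Longrightarrow> \<not> mem s x < mem s y \<Longrightarrow> Q (Suc t) s"
    and init: "I v 0 s"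
  shows "wp N S r (While x y c) Q s"
proof -
  have "\<exists>t' s'. exec N S r (While x y c) s t' s' \<and> Q (t + t') s'" if "I v t s" for v t s
    using that
  proof (induction v arbitrary: t s rule: less_induct)
    case (less v)
    show ?case
    proof (cases "mem s x < mem s y")
      case True
      from body[OF less.prems True] obtain t1 s1 v1 where
        1: "exec N S r c s t1 s1" "v1 < v" "I v1 (Suc (t + t1)) s1"
        unfolding wp_def by blast
      from less.IH[OF 1(2,3)] obtain t2 s2 where
        2: "exec N S r (While x y c) s1 t2 s2" "Q (Suc (t + t1) + t2) s2" by blast
      from exec.While_True[OF True 1(1) 2(1)] 2(2) show ?thesis
        by (intro exI[of _ "Suc (t1 + t2)"] exI[of _ s2]) (simp add: add.assoc)
    next
      case False
      with exit[OF less.prems False] exec.While_False[OF False] show ?thesis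
        by (intro exI[of _ 1] exI[of _ s]) simp
    qed
  qed
  from this[OF init] show ?thesis unfolding wp_def by simp
qed

text \<open>The closing \<open>Skip\<close> costs one step; together with the loop test, a round of
  a \<open>While\<close> whose body is a list of n simple instructions takes n + 2 steps.\<close>

definition seqs :: "program list \<Rightarrow> program" where
  "seqs cs = foldr Seq cs Skip"

lemma wp_seqs [simp]:
  "wp N S r (seqs []) Q s \<longleftrightarrow> Q 1 s"
  "wp N S r (seqs (c # cs)) Q s \<longleftrightarrow> wp N S r c (\<lambda>t. wp N S r (seqs cs) (\<lambda>t'. Q (t + t'))) s"
  by (simp_all add: seqs_def)

section \<open>The program\<close>

text \<open>
  Cell 8 counts the doublings up to \<open>N / \<delta>\<close>, cell 12 is the number of flips in the first phase,
  cell 14 is the number of candidate thresholds, of which cell 15 is the random index, cell 17 is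
  the threshold, cell 18 the budget, cell 19 the coefficient in the stopping rule.
\<close>

definition log_loop :: program where
  "log_loop = While 9 10 (seqs [Arith Mul 9 9 6, Arith Add 8 8 5])"

definition ceiling_loop :: program where
  "ceiling_loop = While 12 11 (Arith Add 12 12 5)"

definition random_loop :: program where
  "random_loop = While 14 13
     (seqs [Toss 16, Arith Mul 15 15 6, Arith Add 15 15 16, Arith Mul 14 14 6])"

definition init_program :: program where
  "init_program = seqs [Const 5 1, Const 6 2, Const 27 4, Const 9 1, Arith Sub 7 2 1, Arith Div 10 0 3]"

definition target_program :: program where
  "target_program = seqs
    [Const 11 1024, Arith Mul 11 11 2, Arith Mul 11 11 8, Arith Div 11 11 7, Arith Div 11 11 7,
     Const 13 24, Arith Mul 13 13 0, Arith Div 13 13 4, Const 14 1]"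

definition threshold_program :: program where
  "threshold_program = seqs
    [Arith Mul 17 15 6, Arith Div 17 17 14, Arith Add 17 17 5, Arith Mul 17 17 7,
     Arith Div 17 17 27, Arith Add 17 17 1]"

definition budget_program :: program where
  "budget_program = seqs
    [Arith Mul 18 14 14, Arith Mul 18 18 12,
     Const 16 64, Arith Mul 19 12 7, Arith Mul 19 19 7, Arith Div 19 19 16]"

definition setup_program :: program where
  "setup_program = seqs
    [init_program, log_loop, target_program, ceiling_loop, random_loop, threshold_program,
     budget_program]"

text \<open>
  For the coin in cell 21, cell 22 counts the heads, cell 23 the flips, and cell 24 is the number of
  flips at the end of the current phase; cell 20 counts the flips of all coins.
\<close>

definition flip_loop :: program where
  "flip_loop = While 23 24
     (seqs [Flip 25 21, Arith Add 22 22 25, Arith Add 23 23 5, Arith Add 20 20 5])"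

text \<open>A further phase is requested by quadrupling cell 24. If the estimate is far enough from
  the threshold or the budget is used up, cell 24 stays equal to cell 23 and the loop ends.\<close>

definition phase_loop :: program where
  "phase_loop = While 23 24
     (seqs [flip_loop, Arith Mul 28 17 23, Arith Sub 29 22 28, Arith Mul 29 29 29,
        Arith Mul 30 23 19,
        If 29 30 (If 20 18 (Arith Mul 24 24 27) Skip) Skip])"

text \<open>\<open>Arith Add 24 12 22\<close> copies cell 12, as cell 22 has just been set to 0. A
  coin that the exhausted budget leaves unsettled is still judged by its current estimate.\<close>

definition coin_loop :: program where
  "coin_loop = While 21 0
     (seqs [Arith Add 21 21 5, Const 22 0, Const 23 0, Arith Add 24 12 22, phase_loop,
        Arith Mul 28 17 23, If 22 28 Skip (Accept 21)])"

definition coin_program :: program where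
  "coin_program = Seq setup_program coin_loop"

fun random_index :: "bits \<Rightarrow> nat \<Rightarrow> nat" where
  "random_index r 0 = 0"
| "random_index r (Suc m) = 2 * random_index r m + of_bool (r m)"

definition heads :: "samples \<Rightarrow> nat \<Rightarrow> nat \<Rightarrow> nat" where
  "heads S i n = (\<Sum>j<n. of_bool (S j i))"

lemma heads_Suc: "heads S i (Suc n) = heads S i n + of_bool (S n i)"
  by (simp add: heads_def)

text \<open>
  \<open>l\<close>, \<open>n\<^sub>0\<close> and \<open>K\<close> are the numbers of rounds of the three loops of the setup.
  The constant 1024 bounds the failure probability of each estimate by \<open>(\<delta> / N)\<^sup>4\<close>, the constant 24
  makes the budget at least \<open>4 / \<rho>\<close> times the bound on the expected number of flips.
\<close>

locale coin_parameters =
  fixes N :: nat and p\<^sub>0 q\<^sub>0 \<delta> \<rho> :: real and l n\<^sub>0 K :: nat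
  assumes N_ge_1: "N \<ge> 1"
    and params: "0 \<le> p\<^sub>0" "p\<^sub>0 < q\<^sub>0" "q\<^sub>0 \<le> 1" "0 < \<delta>" "4 * \<delta> < \<rho>" "\<rho> < 1 / 2"
    and l_iff: "\<And>j. 2 ^ j < real N / \<delta> \<longleftrightarrow> j < l"
    and n0_iff: "\<And>j. real j < 1024 * q\<^sub>0 * real l / (q\<^sub>0 - p\<^sub>0) / (q\<^sub>0 - p\<^sub>0) \<longleftrightarrow> j < n\<^sub>0"
    and K_iff: "\<And>j. 2 ^ j < 24 * real N / \<rho> \<longleftrightarrow> j < K"
begin

section \<open>Quantities computed by the program\<close>

definition threshold :: "bits \<Rightarrow> real" where
  "threshold r = p\<^sub>0 + (q\<^sub>0 - p\<^sub>0) * (1 + 2 * real (random_index r K) / 2 ^ K) / 4"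

definition phase_flips :: "nat \<Rightarrow> nat" where
  "phase_flips k = n\<^sub>0 * 4 ^ k"

text \<open>This is \<open>phase_flips k * (margin k)\<^sup>2\<close> for every \<open>k\<close>:
  the flips grow like 4^k while the squared margin shrinks like 4^(-k). One constant cell thus
  serves all phases.\<close>

definition stop_coeff :: real where
  "stop_coeff = n\<^sub>0 * (q\<^sub>0 - p\<^sub>0) * (q\<^sub>0 - p\<^sub>0) / 64"

text \<open>The condition that the estimate is closer than \<open>margin k\<close> to the threshold,
  multiplied by the number of flips and squared, so that neither an absolute value nor the margin of
  the current phase has to be computed.\<close>

definition undecided :: "samples \<Rightarrow> bits \<Rightarrow> nat \<Rightarrow> nat \<Rightarrow> bool" where
  "undecided S r i k \<longleftrightarrow>
     (real (heads S i (phase_flips k)) - threshold r * phase_flips k)\<^sup>2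
       < phase_flips k * stop_coeff"

definition ready :: "bits \<Rightarrow> state \<Rightarrow> bool" where
  "ready r s \<longleftrightarrow> mem s 0 = N \<and> mem s 5 = 1 \<and> mem s 27 = 4 \<and> mem s 12 = n\<^sub>0 \<and>
     mem s 17 = threshold r \<and> mem s 18 = phase_flips K \<and>
     mem s 19 = stop_coeff"

lemma ready_mem_upd [simp]:
  "x \<notin> {0,5,27,12,17,18,19} \<Longrightarrow> ready r (s\<lparr>mem := f(x := v)\<rparr>) \<longleftrightarrow> ready r (s\<lparr>mem := f\<rparr>)"
  by (simp add: ready_def)

lemma ready_upd [simp]:
  "ready r (s\<lparr>mem := mem s\<rparr>) \<longleftrightarrow> ready r s"
  "ready r (s\<lparr>accepted := A\<rparr>) \<longleftrightarrow> ready r s"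
  "ready r (s\<lparr>mem := f, accepted := A\<rparr>) \<longleftrightarrow> ready r (s\<lparr>mem := f\<rparr>)"
  by (simp_all add: ready_def)

lemma l_pos: "l > 0"
proof -
  have "(2::real) ^ 0 < real N / \<delta>" using N_ge_1 params by (simp add: field_simps)
  then show ?thesis using l_iff by blast
qed

lemma K_pos: "K > 0"
proof -
  have "(2::real) ^ 0 < 24 * real N / \<rho>" using N_ge_1 params by (simp add: field_simps)
  then show ?thesis using K_iff by blast
qed

text \<open>The gap \<open>q\<^sub>0 - p\<^sub>0\<close> is at most \<open>q\<^sub>0\<close> and at
  most 1, so its square is at most \<open>q\<^sub>0\<close> and the target for
  \<open>n\<^sub>0\<close> is at least \<open>1024 * l\<close>. The time for computing
  \<open>l\<close> is then absorbed by \<open>n\<^sub>0\<close>.\<close>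

lemma l_le_n0: "l \<le> n\<^sub>0" and n0_lower: "1024 * q\<^sub>0 * real l / (q\<^sub>0 - p\<^sub>0)\<^sup>2 \<le> real n\<^sub>0"
proof -
  show *: "1024 * q\<^sub>0 * real l / (q\<^sub>0 - p\<^sub>0)\<^sup>2 \<le> real n\<^sub>0"
    using n0_iff[of n\<^sub>0] by (simp add: power2_eq_square not_less divide_divide_eq_left)
  have "(q\<^sub>0 - p\<^sub>0)\<^sup>2 \<le> q\<^sub>0 * 1"
    unfolding power2_eq_square using params by (intro mult_mono) auto
  then have "1024 * real l * (q\<^sub>0 - p\<^sub>0)\<^sup>2 \<le> 1024 * q\<^sub>0 * real l"
    using mult_left_mono[of "(q\<^sub>0 - p\<^sub>0)\<^sup>2" q\<^sub>0 "1024 * real l"] by (simp add: mult_ac)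
  then have "1024 * real l \<le> 1024 * q\<^sub>0 * real l / (q\<^sub>0 - p\<^sub>0)\<^sup>2"
    using params by (simp add: field_simps)
  with * show "l \<le> n\<^sub>0" by linarith
qed

lemma n0_pos: "n\<^sub>0 > 0"
  using l_pos l_le_n0 by simp

lemma phase_flips_pos: "phase_flips k > 0"
  using n0_pos by (simp add: phase_flips_def)

section \<open>The setup and its exact loop counts\<close>

lemma wp_log_loop:
  assumes "mem s 5 = 1" "mem s 6 = 2" "mem s 8 = 0" "mem s 9 = 1" "mem s 10 = N / \<delta>"
    and Q: "\<And>t s'. t = 4 * l + 1 \<Longrightarrow> (\<And>x. x \<noteq> 8 \<Longrightarrow> x \<noteq> 9 \<Longrightarrow> mem s' x = mem s x) \<Longrightarrow>
      mem s' 8 = l \<Longrightarrow> flips s' = flips s \<Longrightarrow> tosses s' = tosses s \<Longrightarrow> accepted s' = accepted s \<Longrightarrow> Q t s'"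
  shows "wp N S r log_loop Q s"
  unfolding log_loop_def
\<comment> \<open>The variant \<open>v\<close> is the number of rounds left. By \<open>l_iff\<close>
  the loop test amounts to \<open>l - v < l\<close>, which fails only for \<open>v = 0\<close>. The
  other two setup loops follow the same pattern.\<close>
proof (rule wp_While[where I = "\<lambda>v t s'. v \<le> l \<and> t = 4 * (l - v) \<and> mem s' 8 = real (l - v) \<and>
      mem s' 9 = 2 ^ (l - v) \<and> (\<forall>x. x \<noteq> 8 \<longrightarrow> x \<noteq> 9 \<longrightarrow> mem s' x = mem s x) \<and> flips s' = flips s \<and>
      tosses s' = tosses s \<and> accepted s' = accepted s" and v = l], goal_cases)
  case (1 v t s')
  then have "l - v < l" using assms l_iff by auto
  then have "v > 0" "l - (v - 1) = Suc (l - v)" using 1 by auto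
  then show ?case using 1 assms by (auto intro!: exI[of _ "v - 1"])
next
  case (2 v t s')
  then have "\<not> l - v < l" using assms l_iff[of "l - v"] by auto
  then have "v = 0" using 2 l_pos by auto
  then show ?case using 2 by (intro Q) auto
next
  case 3
  then show ?case using assms by simp
qed

lemma wp_ceiling_loop:
  assumes "mem s 5 = 1" "mem s 12 = 0" "mem s 11 = 1024 * q\<^sub>0 * real l / (q\<^sub>0 - p\<^sub>0) / (q\<^sub>0 - p\<^sub>0)"
    and Q: "\<And>t s'. t = 2 * n\<^sub>0 + 1 \<Longrightarrow> (\<And>x. x \<noteq> 12 \<Longrightarrow> mem s' x = mem s x) \<Longrightarrow>
      mem s' 12 = n\<^sub>0 \<Longrightarrow> flips s' = flips s \<Longrightarrow> tosses s' = tosses s \<Longrightarrow> accepted s' = accepted s \<Longrightarrow> Q t s'"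
  shows "wp N S r ceiling_loop Q s"
  unfolding ceiling_loop_def
proof (rule wp_While[where I = "\<lambda>v t s'. v \<le> n\<^sub>0 \<and> t = 2 * (n\<^sub>0 - v) \<and> mem s' 12 = real (n\<^sub>0 - v) \<and>
      (\<forall>x. x \<noteq> 12 \<longrightarrow> mem s' x = mem s x) \<and> flips s' = flips s \<and>
      tosses s' = tosses s \<and> accepted s' = accepted s" and v = n\<^sub>0], goal_cases)
  case (1 v t s')
  then have "n\<^sub>0 - v < n\<^sub>0" using assms n0_iff[of "n\<^sub>0 - v"] by auto
  then have "v > 0" "n\<^sub>0 - (v - 1) = Suc (n\<^sub>0 - v)" using 1 by auto
  then show ?case using 1 assms by (auto intro!: exI[of _ "v - 1"])
next
  case (2 v t s')
  then have "\<not> n\<^sub>0 - v < n\<^sub>0" using assms n0_iff[of "n\<^sub>0 - v"] by auto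
  then have "v = 0" using 2 n0_pos by auto
  then show ?case using 2 by (intro Q) auto
next
  case 3
  then show ?case using assms by simp
qed

lemma wp_random_loop:
  assumes "mem s 6 = 2" "mem s 13 = 24 * real N / \<rho>" "mem s 14 = 1" "mem s 15 = 0" "tosses s = 0"
    and Q: "\<And>t s'. t = 6 * K + 1 \<Longrightarrow> (\<And>x. x \<noteq> 14 \<Longrightarrow> x \<noteq> 15 \<Longrightarrow> x \<noteq> 16 \<Longrightarrow> mem s' x = mem s x) \<Longrightarrow>
      mem s' 14 = 2 ^ K \<Longrightarrow> mem s' 15 = random_index r K \<Longrightarrow>
      flips s' = flips s \<Longrightarrow> tosses s' = K \<Longrightarrow> accepted s' = accepted s \<Longrightarrow> Q t s'"
  shows "wp N S r random_loop Q s"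
  unfolding random_loop_def
proof (rule wp_While[where I = "\<lambda>v t s'. v \<le> K \<and> t = 6 * (K - v) \<and>
      mem s' 14 = 2 ^ (K - v) \<and> mem s' 15 = random_index r (K - v) \<and>
      (\<forall>x. x \<noteq> 14 \<longrightarrow> x \<noteq> 15 \<longrightarrow> x \<noteq> 16 \<longrightarrow> mem s' x = mem s x) \<and> flips s' = flips s \<and>
      tosses s' = K - v \<and> accepted s' = accepted s" and v = K], goal_cases)
  case (1 v t s')
  then have "K - v < K" using assms K_iff by auto
  then have "v > 0" "K - (v - 1) = Suc (K - v)" using 1 by auto
  then show ?case using 1 assms by (auto intro!: exI[of _ "v - 1"])
next
  case (2 v t s')
  then have "\<not> K - v < K" using assms K_iff[of "K - v"] by auto
  then have "v = 0" using 2 K_pos by auto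
  then show ?case using 2 by (intro Q) auto
next
  case 3
  then show ?case using assms by simp
qed

lemma wp_init_program:
  assumes Q: "\<And>t s'. t \<le> 10 \<Longrightarrow> mem s' = (mem s)(5 := 1, 6 := 2, 27 := 4, 9 := 1, 7 := mem s 2 - mem s 1,
      10 := mem s 0 / mem s 3) \<Longrightarrow>
      flips s' = flips s \<Longrightarrow> tosses s' = tosses s \<Longrightarrow> accepted s' = accepted s \<Longrightarrow> Q t s'"
  shows "wp N S r init_program Q s"
  by (simp add: init_program_def, rule Q) simp_all

lemma wp_target_program:
  assumes Q: "\<And>t s'. t \<le> 10 \<Longrightarrow> mem s' = (mem s)(11 := 1024 * mem s 2 * mem s 8 / mem s 7 / mem s 7,
      13 := 24 * mem s 0 / mem s 4, 14 := 1) \<Longrightarrow>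
      flips s' = flips s \<Longrightarrow> tosses s' = tosses s \<Longrightarrow> accepted s' = accepted s \<Longrightarrow> Q t s'"
  shows "wp N S r target_program Q s"
  by (simp add: target_program_def, rule Q) simp_all

lemma wp_threshold_program:
  assumes Q: "\<And>t s'. t \<le> 10 \<Longrightarrow> mem s' = (mem s)(17 :=
        (mem s 15 * mem s 6 / mem s 14 + mem s 5) * mem s 7 / mem s 27 + mem s 1) \<Longrightarrow>
      flips s' = flips s \<Longrightarrow> tosses s' = tosses s \<Longrightarrow> accepted s' = accepted s \<Longrightarrow> Q t s'"
  shows "wp N S r threshold_program Q s"
  by (simp add: threshold_program_def, rule Q) simp_all

lemma wp_budget_program:
  assumes Q: "\<And>t s'. t \<le> 10 \<Longrightarrow> mem s' = (mem s)(18 := mem s 14 * mem s 14 * mem s 12, 16 := 64,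
        19 := mem s 12 * mem s 7 * mem s 7 / 64) \<Longrightarrow>
      flips s' = flips s \<Longrightarrow> tosses s' = tosses s \<Longrightarrow> accepted s' = accepted s \<Longrightarrow> Q t s'"
  shows "wp N S r budget_program Q s"
  by (simp add: budget_program_def, rule Q) simp_all

lemma wp_setup_program:
  assumes Q: "\<And>t s. t \<le> 4 * l + 2 * n\<^sub>0 + 6 * K + 60 \<Longrightarrow> ready r s \<Longrightarrow> mem s 20 = 0 \<Longrightarrow> mem s 21 = 0 \<Longrightarrow>
      flips s = (\<lambda>_. 0) \<Longrightarrow> accepted s = {} \<Longrightarrow> Q t s"
  shows "wp N S r setup_program Q (initial_state N p\<^sub>0 q\<^sub>0 \<delta> \<rho>)"
  unfolding setup_program_def wp_seqs
  apply (rule wp_init_program)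
  apply (rule wp_log_loop; (simp add: initial_state_def; fail)?)
  apply (rule wp_target_program)
  apply (rule wp_ceiling_loop; (simp add: initial_state_def; fail)?)
  apply (rule wp_random_loop; (simp add: initial_state_def; fail)?)
  apply (rule wp_threshold_program)
  apply (rule wp_budget_program)
  subgoal premises prems for t0 s0 t1 s1 t2 s2 t3 s3 t4 s4 t5 s5 t6 s6
  proof -
    \<comment> \<open>The budget cell holds \<open>2 ^ K * 2 ^ K * n\<^sub>0\<close>, which this
      identifies with \<open>phase_flips K\<close>.\<close>
    have p4: "(4::real) ^ K = 2 ^ K * 2 ^ K" by (simp flip: power_mult_distrib)
    show ?thesis
      apply (rule Q)
      using prems by (simp_all add: ready_def stop_coeff_def initial_state_def threshold_def phase_flips_def p4 mult_ac)
  qed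
  done

section \<open>Flips, phases and the loop over the coins\<close>

lemma wp_flip_loop:
  assumes ready: "ready r s" and i: "mem s 21 = real i" "i \<in> {1..N}"
    and m: "mem s 24 = real m" "mem s 23 = real n" "n \<le> m"
    and n: "flips s i = n" "mem s 22 = heads S i n" "mem s 20 = real (tot + n)"
    and Q: "\<And>t s'. t = 6 * (m - n) + 1 \<Longrightarrow> (\<And>x. x \<notin> {20,22,23,25} \<Longrightarrow> mem s' x = mem s x) \<Longrightarrow>
      mem s' 20 = real (tot + m) \<Longrightarrow> mem s' 22 = heads S i m \<Longrightarrow> mem s' 23 = real m \<Longrightarrow>
      flips s' = (flips s)(i := m) \<Longrightarrow> accepted s' = accepted s \<Longrightarrow> Q t s'"
  shows "wp N S r flip_loop Q s"
  unfolding flip_loop_def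
proof (rule wp_While[where I = "\<lambda>v t s'. v \<le> m - n \<and> t = 6 * (m - n - v) \<and>
      (\<forall>x. x \<notin> {20,22,23,25} \<longrightarrow> mem s' x = mem s x) \<and>
      mem s' 20 = real (tot + (m - v)) \<and> mem s' 22 = heads S i (m - v) \<and> mem s' 23 = real (m - v) \<and>
      flips s' = (flips s)(i := m - v) \<and> accepted s' = accepted s" and v = "m - n"], goal_cases)
  case (1 v t s')
  then have "v > 0" using m by (auto intro!: Nat.gr0I)
  then have v: "m - (v - 1) = Suc (m - v)" "m - n - (v - 1) = Suc (m - n - v)" using 1 m by auto
  have "mem s' 5 = 1" "mem s' 21 = real i" using 1 i ready by (auto simp: ready_def)
  then show ?case
    using 1 \<open>v > 0\<close> v i m unfolding wp_seqs
    by (intro wp_Flip[where i = i])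
      (auto intro!: exI[of _ "v - 1"] simp: heads_Suc)
next
  case (2 v t s')
  then have "v = 0" using m by auto
  then show ?case using 2 m by (intro Q) auto
next
  case 3
  then show ?case using assms by auto
qed

text \<open>\<open>tot\<close> counts the flips of earlier coins, and \<open>c\<close> is slack for
  first phases, which are run even when the budget is used up. A further phase is entered only if
  \<open>tot + phase_flips k < phase_flips K\<close>, so quadrupling \<open>phase_flips k\<close>
  keeps the total below \<open>4 * phase_flips K\<close>.\<close>

lemma wp_phase_loop:
  assumes ready: "ready r s" and i: "mem s 21 = real i" "i \<in> {1..N}"
    and m: "mem s 24 = real n\<^sub>0" "mem s 23 = 0"
    and n: "flips s i = 0" "mem s 22 = 0" "mem s 20 = real tot" "tot + n\<^sub>0 \<le> 4 * phase_flips K + c"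
    and Q: "\<And>k t s'. k \<le> K \<Longrightarrow> t \<le> 20 * phase_flips k + 1 \<Longrightarrow> ready r s' \<Longrightarrow>
      mem s' 20 = real (tot + phase_flips k) \<Longrightarrow> mem s' 21 = real i \<Longrightarrow>
      mem s' 22 = heads S i (phase_flips k) \<Longrightarrow> mem s' 23 = real (phase_flips k) \<Longrightarrow>
      flips s' = (flips s)(i := phase_flips k) \<Longrightarrow> accepted s' = accepted s \<Longrightarrow>
      (\<And>k'. k' < k \<Longrightarrow> undecided S r i k') \<Longrightarrow>
      (undecided S r i k \<Longrightarrow> phase_flips K \<le> tot + phase_flips k) \<Longrightarrow>
      tot + phase_flips k \<le> 4 * phase_flips K + c \<Longrightarrow> Q t s'"
  shows "wp N S r phase_loop Q s"
  unfolding phase_loop_def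
\<comment> \<open>\<open>k\<close> is the phase whose end is stored in cell 24. Either it is
  complete and the loop is about to stop (\<open>v = 0\<close>), or it is still to be run and at
  most \<open>Suc K - k\<close> phases remain.\<close>
proof (rule wp_While[where I = "\<lambda>v t s'. ready r s' \<and> mem s' 21 = real i \<and> accepted s' = accepted s \<and>
      (\<exists>k n. k \<le> K \<and> t \<le> 20 * n \<and> flips s' = (flips s)(i := n) \<and> mem s' 20 = real (tot + n) \<and>
        mem s' 22 = heads S i n \<and> mem s' 23 = real n \<and> mem s' 24 = phase_flips k \<and>
        (\<forall>k'<k. undecided S r i k') \<and>
        (n = phase_flips k \<and> v = 0 \<and> (undecided S r i k \<longrightarrow> phase_flips K \<le> tot + phase_flips k) \<or>
         n < phase_flips k \<and> v = Suc K - k) \<and> tot + phase_flips k \<le> 4 * phase_flips K + c)"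
    and v = "Suc K"], goal_cases)
  case (1 v t s')
  from 1 obtain k n where
    k: "k \<le> K" "t \<le> 20 * n" "flips s' = (flips s)(i := n)" "mem s' 20 = real (tot + n)"
      "mem s' 22 = heads S i n" "mem s' 23 = real n" "mem s' 24 = phase_flips k"
      "\<And>k'. k' < k \<Longrightarrow> undecided S r i k'" "n < phase_flips k" "v = Suc K - k"
      "tot + phase_flips k \<le> 4 * phase_flips K + c"
    by auto
  have "ready r s'" "mem s' 21 = real i" "accepted s' = accepted s" using 1 by auto
  note s' = this
  show ?case
    unfolding wp_seqs
  proof (rule wp_flip_loop[where i = i and m = "phase_flips k" and n = n and tot = tot], goal_cases)
    case (10 t1 s1)
    have r1: "ready r s1" using s' 10 by (simp add: ready_def)
    have c: "mem s1 17 = threshold r" "mem s1 19 = stop_coeff" "mem s1 18 = phase_flips K" "mem s1 27 = 4"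
      using r1 by (auto simp: ready_def)
    define h where "h = real (heads S i (phase_flips k))"
    have h: "mem s1 22 = h" "mem s1 23 = phase_flips k" "mem s1 20 = real (tot + phase_flips k)"
      using 10 by (simp_all add: h_def)
    have m21: "mem s1 21 = real i" "accepted s1 = accepted s" using 10 s' by auto
    have u: "(h - threshold r * real (phase_flips k)) * (h - threshold r * real (phase_flips k))
        < real (phase_flips k) * stop_coeff \<longleftrightarrow> undecided S r i k"
      by (simp add: undecided_def power2_eq_square h_def)
    have tot: "real (tot + phase_flips k) < real (phase_flips K) \<longleftrightarrow> tot + phase_flips k < phase_flips K"
      by (rule of_nat_less_iff)
    \<comment> \<open>Each flip takes 6 steps and the rest of the round is charged 14. A phase
      contains at least one new flip, so 6 + 14 = 20 steps per flip suffice.\<close>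
    have time: "Suc (t + (6 * (phase_flips k - n) + 13)) \<le> 20 * phase_flips k"
      using k by linarith
    have fl: "flips s1 = (flips s)(i := phase_flips k)" using 10 k by simp
    have m24: "mem s1 24 = phase_flips k" using 10 k by simp
    have p4: "phase_flips (Suc k) = 4 * phase_flips k" by (simp add: phase_flips_def)
    \<comment> \<open>The budget test also limits the phase number, which gives
      \<open>k \<le> K\<close> for the next phase.\<close>
    have k_less: "k < K" if "tot + phase_flips k < phase_flips K"
    proof -
      have "n\<^sub>0 * 4 ^ k < n\<^sub>0 * 4 ^ K" using that unfolding phase_flips_def by linarith
      then show ?thesis by (simp add: n0_pos)
    qed
    show ?case
    proof (cases "undecided S r i k \<and> tot + phase_flips k < phase_flips K")
      case True
      then have "k < K" by (intro k_less) simp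
      moreover have "phase_flips k < 4 * phase_flips k" using phase_flips_pos[of k] by simp
      ultimately show ?thesis
        using True time 10(1) r1 k(8) unfolding wp_If wp_Arith
        apply (simp add: c h u m21 m24 fl tot del: of_nat_add)
        apply (rule exI[of _ "K - k"])
        apply (rule conjI)
         apply (simp add: k(10))
        apply (rule exI[of _ "Suc k"])
        apply (use k(11) in \<open>auto simp: less_Suc_eq p4 h_def\<close>)
        done
    next
      case False
      then show ?thesis
        using time 10(1) r1 k(8) k(1) k(11)
        apply (simp add: c h u m21 m24 fl tot del: of_nat_add)
        apply (rule exI[of _ 0])
        apply (rule conjI)
         apply (use k(1,10) in simp)
        apply (rule exI[of _ k])
        apply (auto simp: h_def)
        done
    qed
  qed (use k s' i in auto)
next
  case (2 v t s')
  then show ?case by (auto intro!: Q)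
next
  case 3
  then show ?case using assms phase_flips_pos[of 0]
    by (auto intro!: exI[of _ 0] simp: heads_def) (auto simp: phase_flips_def)
qed

text \<open>\<open>\<kappa> i\<close> is the last phase run for coin \<open>i\<close>. The claim
  that a coin left undecided has met an exhausted budget survives the later coins because the total
  only grows.\<close>

lemma wp_coin_loop:
  assumes s: "ready r s" "mem s 20 = 0" "mem s 21 = 0" "flips s = (\<lambda>_. 0)" "accepted s = {}"
    and Q: "\<And>\<kappa> t s'. (\<And>i. i \<in> {1..N} \<Longrightarrow> \<kappa> i \<le> K \<and> flips s' i = phase_flips (\<kappa> i) \<and>
          (\<forall>k<\<kappa> i. undecided S r i k) \<and>
          (undecided S r i (\<kappa> i) \<longrightarrow> phase_flips K \<le> (\<Sum>j\<in>{1..N}. flips s' j))) \<Longrightarrow>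
        accepted s' = {i\<in>{1..N}. threshold r * phase_flips (\<kappa> i) \<le> heads S i (phase_flips (\<kappa> i))} \<Longrightarrow>
        (\<Sum>j\<in>{1..N}. flips s' j) \<le> 4 * phase_flips K + N * n\<^sub>0 \<Longrightarrow>
        t \<le> 40 * (\<Sum>j\<in>{1..N}. flips s' j) + 1 \<Longrightarrow> Q t s'"
  shows "wp N S r coin_loop Q s"
  unfolding coin_loop_def
proof -
  define J where "J v t s' \<longleftrightarrow> ready r s' \<and> (\<exists>m \<kappa> tot. v = N - m \<and> m \<le> N \<and>
      mem s' 21 = real m \<and> mem s' 20 = real tot \<and> tot = (\<Sum>j\<in>{1..m}. flips s' j) \<and>
      (\<forall>i\<in>{1..m}. \<kappa> i \<le> K \<and> flips s' i = phase_flips (\<kappa> i) \<and>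
          (\<forall>k<\<kappa> i. undecided S r i k) \<and> (undecided S r i (\<kappa> i) \<longrightarrow> phase_flips K \<le> tot)) \<and>
      (\<forall>i. i > m \<longrightarrow> flips s' i = 0) \<and>
      accepted s' = {i\<in>{1..m}. threshold r * phase_flips (\<kappa> i) \<le> heads S i (phase_flips (\<kappa> i))} \<and>
      tot \<le> 4 * phase_flips K + m * n\<^sub>0 \<and> t \<le> 40 * tot)"
    for v t s'
  show "wp N S r (While 21 0 (seqs [Arith Add 21 21 5, Const 22 0, Const 23 0, Arith Add 24 12 22,
      phase_loop, Arith Mul 28 17 23, If 22 28 Skip (Accept 21)])) Q s"
  proof (rule wp_While[where I = J and v = N], goal_cases)
  case (1 v t s')
  then obtain m \<kappa> tot where m: "v = N - m" "m \<le> N" "mem s' 21 = real m" "mem s' 20 = real tot"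
      "tot = (\<Sum>j\<in>{1..m}. flips s' j)"
      "\<forall>i\<in>{1..m}. \<kappa> i \<le> K \<and> flips s' i = phase_flips (\<kappa> i) \<and>
          (\<forall>k<\<kappa> i. undecided S r i k) \<and> (undecided S r i (\<kappa> i) \<longrightarrow> phase_flips K \<le> tot)"
      "\<forall>i. i > m \<longrightarrow> flips s' i = 0"
      "accepted s' = {i\<in>{1..m}. threshold r * phase_flips (\<kappa> i) \<le> heads S i (phase_flips (\<kappa> i))}"
      "tot \<le> 4 * phase_flips K + m * n\<^sub>0" "t \<le> 40 * tot"
    unfolding J_def by blast
  have r: "ready r s'" using 1 unfolding J_def by blast
  then have c: "mem s' 0 = real N" "mem s' 5 = 1" "mem s' 12 = real n\<^sub>0" by (auto simp: ready_def)
  have "m < N" using 1(2) c m(3) by simp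
  let ?i = "Suc m"
  have i: "?i \<in> {1..N}" using \<open>m < N\<close> by simp
  show ?case
    unfolding wp_seqs wp_Arith wp_Const
  \<comment> \<open>Each coin adds \<open>n\<^sub>0\<close> to the slack, for its unconditional
    first phase.\<close>
  proof (rule wp_phase_loop[where i = ?i and tot = tot and c = "?i * n\<^sub>0"], goal_cases)
    case (10 k t1 s1)
    have c1: "mem s1 17 = threshold r" using 10 by (simp add: ready_def)
    let ?\<kappa> = "\<kappa>(?i := k)"
    define h where "h = real (heads S ?i (phase_flips k))"
    have h: "mem s1 22 = h" using 10 by (simp add: h_def)
    have fl: "flips s1 = (flips s')(?i := phase_flips k)" "accepted s1 = accepted s'" using 10 by simp_all
    have sum: "(\<Sum>j\<in>{1..?i}. flips s1 j) = tot + phase_flips k"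
    proof -
      have "(\<Sum>j\<in>{1..m}. flips s1 j) = tot" unfolding m(5) fl by (intro sum.cong) auto
      then show ?thesis by (simp add: fl)
    qed
    have spec: "\<forall>i\<in>{1..?i}. ?\<kappa> i \<le> K \<and> flips s1 i = phase_flips (?\<kappa> i) \<and>
          (\<forall>k<?\<kappa> i. undecided S r i k) \<and>
          (undecided S r i (?\<kappa> i) \<longrightarrow> phase_flips K \<le> tot + phase_flips k)"
    proof
      fix i assume i: "i \<in> {1..?i}"
      show "?\<kappa> i \<le> K \<and> flips s1 i = phase_flips (?\<kappa> i) \<and>
          (\<forall>k<?\<kappa> i. undecided S r i k) \<and>
          (undecided S r i (?\<kappa> i) \<longrightarrow> phase_flips K \<le> tot + phase_flips k)"
      proof (cases "i = ?i")
        case True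
        then show ?thesis using 10 fl by simp
      next
        case False
        then have "i \<in> {1..m}" using i by auto
        then show ?thesis using m(6) False by (auto simp: fl trans_le_add1)
      qed
    qed
    have zero: "\<forall>i. i > ?i \<longrightarrow> flips s1 i = 0" using m(7) by (simp add: fl)
    have acc: "{i\<in>{1..?i}. threshold r * phase_flips (?\<kappa> i) \<le> heads S i (phase_flips (?\<kappa> i))} =
        (if h < threshold r * phase_flips k then accepted s1 else insert ?i (accepted s1))"
    proof -
      have "{1..?i} = insert ?i {1..m}" by auto
      then show ?thesis unfolding fl m(8) h_def by auto
    qed
    have I: "\<exists>v'<v. J v' t2 s2"
      if s2: "ready r s2" "flips s2 = flips s1" "mem s2 20 = mem s1 20" "mem s2 21 = mem s1 21"
        "accepted s2 = (if h < threshold r * phase_flips k then accepted s1 else insert ?i (accepted s1))"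
        "t2 \<le> t + t1 + 15"
      for s2 t2
      unfolding J_def
    proof (rule exI[of _ "N - ?i"], intro conjI, goal_cases)
      case 3
      show ?case
      proof (rule exI[of _ ?i], rule exI[of _ ?\<kappa>], rule exI[of _ "tot + phase_flips k"], intro conjI)
      \<comment> \<open>The phases of this coin take at most \<open>20 * phase_flips k + 1\<close>
        steps and the other instructions are charged 15; the excess of 16 is covered by a single
        flip at rate 40.\<close>
      have "phase_flips k \<ge> 1" using phase_flips_pos[of k] by simp
      then have "t + t1 + 15 \<le> 40 * (tot + phase_flips k)"
        using 10(2) m(10) unfolding add_mult_distrib2 by linarith
      then show "t2 \<le> 40 * (tot + phase_flips k)" using s2 by simp
      qed (use s2 10 m i sum spec zero acc \<open>m < N\<close> in simp_all)
    qed (use s2 m \<open>m < N\<close> in simp_all)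
    have m1: "mem s1 23 = phase_flips k" "mem s1 21 = real ?i" using 10 by simp_all
    have r1: "ready r s1" using 10 by simp
    show ?case
    proof (cases "h < threshold r * phase_flips k")
      case True
      then show ?thesis
        apply (simp add: c1 h m1)
        apply (rule I)
        apply (simp_all add: r1)
        done
    next
      case False
      then show ?thesis
        apply (simp add: c1 h m1)
        apply (rule wp_Accept[where i = ?i])
          apply (simp add: m1)
         apply (use i in simp)
        apply (rule I)
        apply (simp_all add: r1)
        done
    qed
  qed (use m r c i in simp_all)
next
  case (2 v t s')
  then obtain m \<kappa> where m: "m \<le> N" "mem s' 21 = real m"
      "\<forall>i\<in>{1..m}. \<kappa> i \<le> K \<and> flips s' i = phase_flips (\<kappa> i) \<and>
          (\<forall>k<\<kappa> i. undecided S r i k) \<and>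
          (undecided S r i (\<kappa> i) \<longrightarrow> phase_flips K \<le> (\<Sum>j\<in>{1..m}. flips s' j))"
      "accepted s' = {i\<in>{1..m}. threshold r * phase_flips (\<kappa> i) \<le> heads S i (phase_flips (\<kappa> i))}"
      "(\<Sum>j\<in>{1..m}. flips s' j) \<le> 4 * phase_flips K + m * n\<^sub>0"
      "t \<le> 40 * (\<Sum>j\<in>{1..m}. flips s' j)"
    unfolding J_def by blast
  have "mem s' 0 = real N" using 2 by (simp add: ready_def J_def)
  then have "m = N" using m 2 by simp
  show ?case
    using m unfolding \<open>m = N\<close> by (intro Q[of \<kappa>]) (blast | simp)+
next
  case 3
  then show ?case using s by (auto simp: J_def)
qed
qed

section \<open>Runs of the whole program\<close>

abbreviation start :: state where
  "start \<equiv> initial_state N p\<^sub>0 q\<^sub>0 \<delta> \<rho>"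

lemma coin_program_run:
  "\<exists>t s \<kappa>. exec N S r coin_program start t s \<and>
     (\<forall>i\<in>{1..N}. \<kappa> i \<le> K \<and> flips s i = phase_flips (\<kappa> i) \<and>
       (\<forall>k<\<kappa> i. undecided S r i k) \<and>
       (undecided S r i (\<kappa> i) \<longrightarrow> phase_flips K \<le> (\<Sum>j\<in>{1..N}. flips s j))) \<and>
     accepted s = {i\<in>{1..N}. threshold r * phase_flips (\<kappa> i) \<le> heads S i (phase_flips (\<kappa> i))} \<and>
     (\<Sum>j\<in>{1..N}. flips s j) \<le> 4 * phase_flips K + N * n\<^sub>0 \<and>
     t \<le> 40 * (\<Sum>j\<in>{1..N}. flips s j) + 4 * l + 2 * n\<^sub>0 + 6 * K + 61"
proof -
  have "wp N S r coin_program (\<lambda>t s. \<exists>\<kappa>.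
     (\<forall>i\<in>{1..N}. \<kappa> i \<le> K \<and> flips s i = phase_flips (\<kappa> i) \<and>
       (\<forall>k<\<kappa> i. undecided S r i k) \<and>
       (undecided S r i (\<kappa> i) \<longrightarrow> phase_flips K \<le> (\<Sum>j\<in>{1..N}. flips s j))) \<and>
     accepted s = {i\<in>{1..N}. threshold r * phase_flips (\<kappa> i) \<le> heads S i (phase_flips (\<kappa> i))} \<and>
     (\<Sum>j\<in>{1..N}. flips s j) \<le> 4 * phase_flips K + N * n\<^sub>0 \<and>
     t \<le> 40 * (\<Sum>j\<in>{1..N}. flips s j) + 4 * l + 2 * n\<^sub>0 + 6 * K + 61) start"
    unfolding coin_program_def wp_Seq
  proof (rule wp_setup_program, rule wp_coin_loop, goal_cases)
    case (6 t s \<kappa> t' s')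
    show ?case
    proof (intro exI[of _ \<kappa>] conjI)
      show "t + t' \<le> 40 * (\<Sum>j\<in>{1..N}. flips s' j) + 4 * l + 2 * n\<^sub>0 + 6 * K + 61"
        using 6 by linarith
    qed (use 6 in blast)+
  qed
  then show ?thesis unfolding wp_def by blast
qed

lemma always_halts: "always_halts coin_program N start"
  unfolding always_halts_def using coin_program_run by blast

lemma exec_final_state:
  "exec N S r coin_program start (running_time coin_program N start S r)
     (final_state coin_program N start S r)"
proof -
  obtain t s where ex: "exec N S r coin_program start t s" using coin_program_run by blast
  have "running_time coin_program N start S r = t" "final_state coin_program N start S r = s"
    unfolding running_time_def final_state_def
    using ex exec_deterministic[OF _ ex] by (blast intro!: the_equality)+
  with ex show ?thesis by simp
qed

abbreviation "output \<equiv> coin_output coin_program N start"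
abbreviation "total_flips \<equiv> coordinate_samples coin_program N start"

text \<open>The content of a run without memory or states, from which the analysis of the output
  starts.\<close>

lemma coin_program_spec:
  obtains \<kappa> where
    "\<And>i. i \<in> {1..N} \<Longrightarrow> \<kappa> i \<le> K"
    "\<And>i k. i \<in> {1..N} \<Longrightarrow> k < \<kappa> i \<Longrightarrow> undecided S r i k"
    "\<And>i. i \<in> {1..N} \<Longrightarrow> undecided S r i (\<kappa> i) \<Longrightarrow> phase_flips K \<le> total_flips S r"
    "output S r =
       {i\<in>{1..N}. threshold r * phase_flips (\<kappa> i) \<le> heads S i (phase_flips (\<kappa> i))}"
    "total_flips S r = (\<Sum>i\<in>{1..N}. phase_flips (\<kappa> i))"
proof -
  let ?s = "final_state coin_program N start S r"
  obtain t s \<kappa> where s: "exec N S r coin_program start t s"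
    "(\<forall>i\<in>{1..N}. \<kappa> i \<le> K \<and> flips s i = phase_flips (\<kappa> i) \<and>
       (\<forall>k<\<kappa> i. undecided S r i k) \<and>
       (undecided S r i (\<kappa> i) \<longrightarrow> phase_flips K \<le> (\<Sum>j\<in>{1..N}. flips s j)))"
    "accepted s = {i\<in>{1..N}. threshold r * phase_flips (\<kappa> i) \<le> heads S i (phase_flips (\<kappa> i))}"
    using coin_program_run[of S r] by blast
  have "?s = s" using exec_deterministic[OF s(1) exec_final_state] by simp
  then have out: "output S r = accepted s" and tot: "total_flips S r = (\<Sum>j\<in>{1..N}. flips s j)"
    by (simp_all add: coordinate_samples_def coin_output_def)
  have "(\<Sum>j\<in>{1..N}. flips s j) = (\<Sum>i\<in>{1..N}. phase_flips (\<kappa> i))"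
    using s(2) by (intro sum.cong) blast+
  then have tot': "total_flips S r = (\<Sum>i\<in>{1..N}. phase_flips (\<kappa> i))" using tot by simp
  show ?thesis
  proof (rule that[of \<kappa>])
    show "output S r =
        {i\<in>{1..N}. threshold r * phase_flips (\<kappa> i) \<le> heads S i (phase_flips (\<kappa> i))}"
      unfolding out by (rule s(3))
    show "phase_flips K \<le> total_flips S r" if "i \<in> {1..N}" "undecided S r i (\<kappa> i)" for i
      using s(2) that unfolding tot by blast
  qed (use s(2) tot' in blast)+
qed

lemma total_flips_le: "total_flips S r \<le> 4 * phase_flips K + N * n\<^sub>0"
  and running_time_le: "running_time coin_program N start S r
        \<le> 40 * total_flips S r + 4 * l + 2 * n\<^sub>0 + 6 * K + 61"
proof -
  obtain t s where s: "exec N S r coin_program start t s"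
    "(\<Sum>j\<in>{1..N}. flips s j) \<le> 4 * phase_flips K + N * n\<^sub>0"
    "t \<le> 40 * (\<Sum>j\<in>{1..N}. flips s j) + 4 * l + 2 * n\<^sub>0 + 6 * K + 61"
    using coin_program_run[of S r] by blast
  have "running_time coin_program N start S r = t" "final_state coin_program N start S r = s"
    using exec_deterministic[OF s(1) exec_final_state] by simp_all
  with s show "total_flips S r \<le> 4 * phase_flips K + N * n\<^sub>0"
    "running_time coin_program N start S r \<le> 40 * total_flips S r + 4 * l + 2 * n\<^sub>0 + 6 * K + 61"
    by (simp_all add: coordinate_samples_def)
qed

end

section \<open>Samples and random bits\<close>

text \<open>Points are classified by which of the \<open>P j\<close> hold. There are finitely many
  classes, each measurable, and \<open>f\<close> is constant on every class.\<close>

lemma pred_finite_dependence: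
  assumes "finite J" and P: "\<And>j. j \<in> J \<Longrightarrow> {x \<in> space M. P j x} \<in> sets M"
    and f: "\<And>x y. x \<in> space M \<Longrightarrow> y \<in> space M \<Longrightarrow> (\<And>j. j \<in> J \<Longrightarrow> P j x \<longleftrightarrow> P j y) \<Longrightarrow> f x \<Longrightarrow> f y"
  shows "{x \<in> space M. f x} \<in> sets M"
proof -
  define \<A> where "\<A> = (\<lambda>x. {j \<in> J. P j x}) ` {x \<in> space M. f x}"
  have "\<A> \<subseteq> Pow J" unfolding \<A>_def by auto
  then have "finite \<A>" using \<open>finite J\<close> by (meson finite_Pow_iff finite_subset)
  have "{x \<in> space M. \<forall>j\<in>J. P j x \<longleftrightarrow> j \<in> A} \<in> sets M" for A
  proof (rule sets.sets_Collect_finite_All[OF _ \<open>finite J\<close>])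
    fix j assume "j \<in> J"
    then show "{x \<in> space M. P j x \<longleftrightarrow> j \<in> A} \<in> sets M"
      using P[of j] sets.sets_Collect_neg[OF P[of j]] by (cases "j \<in> A") simp_all
  qed
  then have "(\<Union>A\<in>\<A>. {x \<in> space M. \<forall>j\<in>J. P j x \<longleftrightarrow> j \<in> A}) \<in> sets M"
    using \<open>finite \<A>\<close> by (intro sets.finite_UN) auto
  also have "(\<Union>A\<in>\<A>. {x \<in> space M. \<forall>j\<in>J. P j x \<longleftrightarrow> j \<in> A}) = {x \<in> space M. f x}"
  proof (intro equalityI subsetI)
    fix x assume "x \<in> (\<Union>A\<in>\<A>. {x \<in> space M. \<forall>j\<in>J. P j x \<longleftrightarrow> j \<in> A})"
    then obtain y where y: "x \<in> space M" "y \<in> space M" "f y" "\<forall>j\<in>J. P j x \<longleftrightarrow> j \<in> {j \<in> J. P j y}"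
      unfolding \<A>_def by auto
    then show "x \<in> {x \<in> space M. f x}" using f[of y x] by auto
  next
    fix x assume "x \<in> {x \<in> space M. f x}"
    then show "x \<in> (\<Union>A\<in>\<A>. {x \<in> space M. \<forall>j\<in>J. P j x \<longleftrightarrow> j \<in> A})"
      unfolding \<A>_def by auto
  qed
  finally show ?thesis .
qed

lemma exec_bounds:
  assumes "exec N S r c s t s'"
  shows "flips s i \<le> flips s' i \<and> flips s' i \<le> flips s i + t \<and>
    tosses s \<le> tosses s' \<and> tosses s' \<le> tosses s + t"
  using assms by (induction rule: exec.induct) auto

text \<open>A run reads only entries below its final counters. As the counters never decrease
  (\<open>exec_bounds\<close>), agreement below the final counters also covers the first part of a
  composite run.\<close>

lemma exec_cong:
  assumes "exec N S r c s t s'"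
    and "\<And>k i. i \<in> {1..N} \<Longrightarrow> k < flips s' i \<Longrightarrow> S' k i = S k i"
    and "\<And>j. j < tosses s' \<Longrightarrow> r' j = r j"
  shows "exec N S' r' c s t s'"
  using assms
proof (induction rule: exec.induct)
  case (Flip s y i x)
  then have "S' (flips s i) i = S (flips s i) i" by simp
  with exec.Flip[OF Flip(1,2), of S' r' x] show ?case by simp
next
  case (Toss x s)
  then have "r' (tosses s) = r (tosses s)" by simp
  with exec.Toss[of N S' r' x s] show ?case by simp
next
  case (Seq c s t s' d t' s'')
  have b: "flips s' i \<le> flips s'' i" "tosses s' \<le> tosses s''" for i
    using exec_bounds[OF Seq.hyps(2)] by auto
  show ?case
    by (rule exec.Seq; rule Seq.IH; use Seq.prems b order.strict_trans2 in blast)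
next
  case (While_True s x y c t s' t' s'')
  have b: "flips s' i \<le> flips s'' i" "tosses s' \<le> tosses s''" for i
    using exec_bounds[OF While_True.hyps(3)] by auto
  show ?case
    by (rule exec.While_True[OF While_True.hyps(1)]; rule While_True.IH;
        use While_True.prems b order.strict_trans2 in blast)
qed (blast intro: exec.intros)+

lemma prob_space_iid_samples: "prob_space (iid_samples D)"
  unfolding iid_samples_def by (intro prob_space_PiM measure_pmf.prob_space_axioms)

lemma prob_space_random_bits: "prob_space random_bits"
  unfolding random_bits_def by (intro prob_space_PiM measure_pmf.prob_space_axioms)

lemma space_iid_samples [simp]: "space (iid_samples D) = UNIV"
  by (simp add: iid_samples_def space_PiM)

lemma space_random_bits [simp]: "space random_bits = UNIV"
  by (simp add: random_bits_def space_PiM)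

lemma measurable_sample [measurable]: "(\<lambda>S. S k i) \<in> measurable (iid_samples D) (count_space UNIV)"
proof -
  have "(\<lambda>S. S k) \<in> measurable (iid_samples D) (measure_pmf D)"
    unfolding iid_samples_def by (rule measurable_component_singleton) simp
  moreover have "(\<lambda>x. x i) \<in> measurable (measure_pmf D) (count_space UNIV)" by simp
  ultimately show ?thesis by (rule measurable_compose)
qed

lemma measurable_random_bit [measurable]: "(\<lambda>r. r j) \<in> measurable random_bits (count_space UNIV)"
proof -
  have "(\<lambda>r. r j) \<in> measurable random_bits (measure_pmf (bernoulli_pmf (1/2)))"
    unfolding random_bits_def by (rule measurable_component_singleton) simp
  then show ?thesis by simp
qed

section \<open>Chernoff bounds for the number of heads\<close>

lemma nn_integral_iid_prod:
  fixes f :: "(nat \<Rightarrow> bool) \<Rightarrow> ennreal"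
  shows "(\<integral>\<^sup>+ S. (\<Prod>k<n. f (S k)) \<partial>iid_samples D) = (\<integral>\<^sup>+ x. f x \<partial>measure_pmf D) ^ n"
proof -
  interpret product_prob_space "\<lambda>_::nat. measure_pmf D" UNIV
    by unfold_locales
  \<comment> \<open>Only the first \<open>n\<close> tosses matter; their law is a finite product
    measure, over which a product integrates factor by factor.\<close>
  let ?J = "{..<n}"
  have "(\<integral>\<^sup>+ S. (\<Prod>k<n. f (S k)) \<partial>iid_samples D) =
      (\<integral>\<^sup>+ S. (\<Prod>k<n. f (restrict S ?J k)) \<partial>iid_samples D)"
    by (intro nn_integral_cong prod.cong) auto
  also have "\<dots> = (\<integral>\<^sup>+ S. (\<Prod>k<n. f (S k)) \<partial>distr (iid_samples D) (Pi\<^sub>M ?J (\<lambda>_. measure_pmf D)) (\<lambda>S. restrict S ?J))"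
    unfolding iid_samples_def by (subst nn_integral_distr) (auto intro!: measurable_restrict_subset
        borel_measurable_prod_ennreal measurable_compose[OF measurable_component_singleton[of _ ?J]])
  also have "distr (iid_samples D) (Pi\<^sub>M ?J (\<lambda>_. measure_pmf D)) (\<lambda>S. restrict S ?J) = Pi\<^sub>M ?J (\<lambda>_. measure_pmf D)"
    unfolding iid_samples_def by (subst distr_PiM_restrict_finite) (auto intro: measure_pmf.prob_space_axioms)
  also have "(\<integral>\<^sup>+ S. (\<Prod>k<n. f (S k)) \<partial>Pi\<^sub>M ?J (\<lambda>_. measure_pmf D)) = (\<Prod>k<n. \<integral>\<^sup>+ x. f x \<partial>measure_pmf D)"
    by (rule product_nn_integral_prod) auto
  finally show ?thesis by simp
qed

lemma measurable_heads [measurable]: "(\<lambda>S. real (heads S i n)) \<in> borel_measurable (iid_samples D)"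
  unfolding heads_def of_nat_sum of_nat_of_bool by measurable

text \<open>Markov's inequality for the exponential of \<open>z * heads S i n\<close>: independence
  turns its mean into a power, and 1 + x \<le> exp x bounds the factors. Since \<open>z\<close> may
  have either sign, both tails are covered.\<close>

lemma prob_heads_ge:
  "measure (iid_samples D) {S. c \<le> z * real (heads S i n)} \<le>
     exp (n * (bias D i * (exp z - 1)) - c)"
proof -
  interpret prob_space "iid_samples D" by (rule prob_space_iid_samples)
  define u where "u = (\<lambda>S::samples. \<Prod>k<n. ennreal (exp (z * of_bool (S k i))))"
  have u: "u S = ennreal (exp (z * real (heads S i n)))" for S
  proof -
    have "u S = ennreal (\<Prod>k<n. exp (z * of_bool (S k i)))"
      unfolding u_def by (simp add: prod_ennreal)
    also have "(\<Prod>k<n. exp (z * of_bool (S k i))) = exp (\<Sum>k<n. z * of_bool (S k i))"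
      by (simp only: exp_sum finite_lessThan)
    also have "(\<Sum>k<n. z * of_bool (S k i)) = z * real (heads S i n)"
      by (simp only: heads_def of_nat_sum of_nat_of_bool sum_distrib_left)
    finally show ?thesis .
  qed
  have [measurable]: "u \<in> borel_measurable (iid_samples D)"
    unfolding u_def by (intro borel_measurable_prod_ennreal) measurable
  have b: "bias D i = measure_pmf.prob D {x. x i}" by (simp add: bias_def)
  have "(\<integral>\<^sup>+ x. ennreal (exp (z * of_bool (x i))) \<partial>measure_pmf D) =
      ennreal (\<integral>x. exp (z * of_bool (x i)) \<partial>measure_pmf D)"
    by (intro nn_integral_eq_integral measure_pmf.integrable_const_bound[where B = "max 1 (exp z)"]) auto
  also have "(\<integral>x. exp (z * of_bool (x i)) \<partial>measure_pmf D) =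
      (\<integral>x. 1 + (exp z - 1) * indicator {x. x i} x \<partial>measure_pmf D)"
    by (intro Bochner_Integration.integral_cong) auto
  also have "\<dots> = 1 + bias D i * (exp z - 1)"
    by (subst Bochner_Integration.integral_add)
      (auto simp: b intro!: integrable_mult_right measure_pmf.integrable_const_bound[where B = 1])
  also have "\<dots> \<le> exp (bias D i * (exp z - 1))"
    by (rule exp_ge_add_one_self)
  finally have mgf: "(\<integral>\<^sup>+ x. ennreal (exp (z * of_bool (x i))) \<partial>measure_pmf D) \<le>
      ennreal (exp (bias D i * (exp z - 1)))"
    by (simp add: ennreal_leI)
  have "emeasure (iid_samples D) {S. c \<le> z * real (heads S i n)} \<le>
      emeasure (iid_samples D) {S \<in> space (iid_samples D). 1 \<le> ennreal (exp (- c)) * u S}"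
  proof (rule emeasure_mono)
    have "1 \<le> ennreal (exp (- c)) * u S" if "c \<le> z * real (heads S i n)" for S
      unfolding u using that by (simp add: ennreal_mult[symmetric] exp_minus flip: exp_add)
        (simp add: field_simps)
    then show "{S. c \<le> z * real (heads S i n)} \<subseteq>
        {S \<in> space (iid_samples D). 1 \<le> ennreal (exp (- c)) * u S}" by auto
  qed measurable
  also have "\<dots> \<le> ennreal (exp (- c)) * (\<integral>\<^sup>+ S. u S * indicator (space (iid_samples D)) S \<partial>iid_samples D)"
    by (rule nn_integral_Markov_inequality) (use sets.top[of "iid_samples D"] in auto)
  also have "(\<integral>\<^sup>+ S. u S * indicator (space (iid_samples D)) S \<partial>iid_samples D) =
      (\<integral>\<^sup>+ x. ennreal (exp (z * of_bool (x i))) \<partial>measure_pmf D) ^ n"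
    by (simp add: u_def nn_integral_iid_prod[where f = "\<lambda>x. ennreal (exp (z * of_bool (x i)))"])
  also have "\<dots> \<le> ennreal (exp (bias D i * (exp z - 1))) ^ n"
    by (intro power_mono mgf) auto
  also have "\<dots> = ennreal (exp (n * (bias D i * (exp z - 1))))"
    by (simp add: ennreal_power exp_of_nat_mult)
  finally have "emeasure (iid_samples D) {S. c \<le> z * real (heads S i n)} \<le>
      ennreal (exp (- c) * exp (n * (bias D i * (exp z - 1))))"
    by (simp add: ennreal_mult mult_left_mono)
  also have "exp (- c) * exp (n * (bias D i * (exp z - 1))) = exp (n * (bias D i * (exp z - 1)) - c)"
    by (simp flip: exp_add)
  finally show ?thesis by (simp add: emeasure_eq_measure)
qed

text \<open>Combines exp (- x) \<le> 1 / (1 + x) with (1 - x + x^2) (1 + x) = 1 + x^3 \<ge>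
  1.\<close>

lemma exp_minus_le:
  fixes x :: real
  assumes "0 \<le> x"
  shows "exp (- x) \<le> 1 - x + x\<^sup>2"
proof -
  have "1 + x \<le> exp x" by (rule exp_ge_add_one_self)
  then have "exp (- x) \<le> 1 / (1 + x)"
    using assms by (simp add: exp_minus field_simps)
  also have "(1 - x + x\<^sup>2) * (1 + x) = 1 + x ^ 3"
    by (simp add: algebra_simps power2_eq_square power3_eq_cube)
  then have "1 / (1 + x) \<le> 1 - x + x\<^sup>2"
    using assms by (simp add: divide_le_eq)
  finally show ?thesis .
qed

lemma bias_nonneg: "0 \<le> bias D i"
  by (simp add: bias_def)

text \<open>The choice z = \<Delta> / (2 q) minimizes q z^2 - z \<Delta>, and
  \<open>\<Delta> \<le> 2 * q\<close> gives z \<le> 1, where exp z \<le> 1 + z + z^2. The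
  \<open>q\<close> in the denominator of the exponent is what makes the cost linear in
  \<open>q\<^sub>0\<close>.\<close>

lemma chernoff_upper:
  assumes "bias D i \<le> q" "0 < \<Delta>" "\<Delta> \<le> 2 * q"
  shows "measure (iid_samples D) {S. n * (bias D i + \<Delta>) \<le> real (heads S i n)} \<le>
    exp (- (n * \<Delta>\<^sup>2 / (4 * q)))"
proof -
  define z where "z = \<Delta> / (2 * q)"
  have q: "q > 0" using assms by simp
  have z: "0 < z" "z \<le> 1" using assms q by (auto simp: z_def field_simps)
  have "{S. n * (bias D i + \<Delta>) \<le> real (heads S i n)} =
      {S. z * (n * (bias D i + \<Delta>)) \<le> z * real (heads S i n)}"
    using z by simp
  then have "measure (iid_samples D) {S. n * (bias D i + \<Delta>) \<le> real (heads S i n)} \<le>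
      exp (n * (bias D i * (exp z - 1)) - z * (n * (bias D i + \<Delta>)))"
    using prob_heads_ge[of D "z * (n * (bias D i + \<Delta>))" z i n] by simp
  also have "\<dots> \<le> exp (- (n * \<Delta>\<^sup>2 / (4 * q)))"
  proof -
    have "exp z - 1 \<le> z + z\<^sup>2" using exp_bound[of z] z by simp
    then have "bias D i * (exp z - 1) \<le> bias D i * (z + z\<^sup>2)"
      by (intro mult_left_mono bias_nonneg)
    moreover have "bias D i * z\<^sup>2 \<le> q * z\<^sup>2" using assms by (intro mult_right_mono) auto
    ultimately have "bias D i * (exp z - 1) - z * (bias D i + \<Delta>) \<le> q * z\<^sup>2 - z * \<Delta>"
      by (simp add: algebra_simps)
    also have "\<dots> = - (\<Delta>\<^sup>2 / (4 * q))"
      using q by (simp add: z_def field_simps power2_eq_square)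
    finally have "n * (bias D i * (exp z - 1) - z * (bias D i + \<Delta>)) \<le> n * (- (\<Delta>\<^sup>2 / (4 * q)))"
      by (intro mult_left_mono) auto
    then show ?thesis by (simp add: algebra_simps)
  qed
  finally show ?thesis .
qed

lemma chernoff_lower:
  assumes "0 < q" "0 < \<Delta>" "\<Delta> \<le> 2 * q"
  shows "measure (iid_samples D) {S. real (heads S i n) \<le> n * (min (bias D i) q - \<Delta>)} \<le>
    exp (- (n * \<Delta>\<^sup>2 / (4 * q)))"
proof -
  define z where "z = \<Delta> / (2 * q)"
  define a where "a = min (bias D i) q"
  have z: "0 < z" "z \<le> 1" using assms by (auto simp: z_def field_simps)
  have "{S. real (heads S i n) \<le> n * (a - \<Delta>)} =
      {S. - z * (n * (a - \<Delta>)) \<le> - z * real (heads S i n)}"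
    using z by simp
  then have "measure (iid_samples D) {S. real (heads S i n) \<le> n * (a - \<Delta>)} \<le>
      exp (n * (bias D i * (exp (- z) - 1)) - (- z * (n * (a - \<Delta>))))"
    using prob_heads_ge[of D "- z * (n * (a - \<Delta>))" "- z" i n] by simp
  also have "\<dots> \<le> exp (- (n * \<Delta>\<^sup>2 / (4 * q)))"
  proof -
    have "exp (- z) - 1 \<le> - z + z\<^sup>2" using exp_minus_le[of z] z by simp
    then have "bias D i * (exp (- z) - 1) \<le> bias D i * (- z + z\<^sup>2)"
      by (intro mult_left_mono bias_nonneg)
    also have "z\<^sup>2 \<le> z" using z by (simp add: power2_eq_square)
    then have "bias D i * (- z + z\<^sup>2) \<le> a * (- z + z\<^sup>2)"
      by (intro mult_right_mono_neg) (auto simp: a_def)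
    finally have "bias D i * (exp (- z) - 1) + z * (a - \<Delta>) \<le> a * z\<^sup>2 - z * \<Delta>"
      by (simp add: algebra_simps)
    also have "a * z\<^sup>2 \<le> q * z\<^sup>2" by (intro mult_right_mono) (auto simp: a_def)
    also have "q * z\<^sup>2 - z * \<Delta> = - (\<Delta>\<^sup>2 / (4 * q))"
      using assms by (simp add: z_def field_simps power2_eq_square)
    finally have "n * (bias D i * (exp (- z) - 1) + z * (a - \<Delta>)) \<le> n * (- (\<Delta>\<^sup>2 / (4 * q)))"
      by (intro mult_left_mono) auto
    then show ?thesis by (simp add: algebra_simps)
  qed
  finally show ?thesis unfolding a_def .
qed

section \<open>Anti-concentration of the random index\<close>

lemma random_index_inj:
  assumes "random_index r m = random_index r' m" and "j < m"
  shows "r j = r' j"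
  using assms
proof (induction m)
  case (Suc m)
  have eq: "2 * random_index r m + of_bool (r m) = 2 * random_index r' m + of_bool (r' m)"
    using Suc.prems(1) by simp
  then have bit: "r m = r' m" by (cases "r m"; cases "r' m"; simp; presburger)
  with eq have "random_index r m = random_index r' m" by simp
  then show ?case using Suc.IH Suc.prems(2) bit less_SucE by blast
qed simp

lemma measurable_random_index [measurable]:
  "(\<lambda>r. random_index r m) \<in> measurable random_bits (count_space UNIV)"
proof (induction m)
  case (Suc m)
  note [measurable] = Suc
  show ?case unfolding random_index.simps by measurable
qed simp

text \<open>The index determines the first \<open>m\<close> bits, so the event lies in a cylinder
  with \<open>m\<close> fixed fair bits.\<close>

lemma prob_random_index_le: "measure random_bits {r. random_index r m = v} \<le> 1 / 2 ^ m"
proof (cases "\<exists>r. random_index r m = v")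
  case False
  then show ?thesis by simp
next
  case True
  then obtain b where b: "random_index b m = v" by blast
  interpret prob_space random_bits by (rule prob_space_random_bits)
  let ?B = "\<lambda>_::nat. measure_pmf (bernoulli_pmf (1/2))"
  let ?C = "prod_emb UNIV ?B {..<m} (Pi\<^sub>E {..<m} (\<lambda>j. {b j}))"
  have "{r. random_index r m = v} \<subseteq> ?C"
  proof
    fix r assume "r \<in> {r. random_index r m = v}"
    then have "r j = b j" if "j < m" for j using random_index_inj[of r m b j] b that by simp
    then show "r \<in> ?C" by (auto simp: prod_emb_def PiE_iff)
  qed
  then have "emeasure random_bits {r. random_index r m = v} \<le> emeasure random_bits ?C"
    by (rule emeasure_mono) (simp add: random_bits_def sets_PiM_I)
  also have "\<dots> = (\<Prod>j<m. emeasure (measure_pmf (bernoulli_pmf (1/2))) {b j})"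
    unfolding random_bits_def
    by (intro emeasure_PiM_emb) (auto intro: measure_pmf.prob_space_axioms)
  also have "\<dots> = (\<Prod>j<m. ennreal (1/2))"
  proof (intro prod.cong refl)
    fix j show "emeasure (measure_pmf (bernoulli_pmf (1/2))) {b j} = ennreal (1/2)"
      by (cases "b j") (simp_all add: emeasure_pmf_single)
  qed
  also have "\<dots> = ennreal (1 / 2 ^ m)"
    by (simp only: prod_constant card_lessThan ennreal_power power_one_over zero_le_divide_1_iff
        zero_le_numeral)
  finally show ?thesis by (simp add: emeasure_eq_measure)
qed

lemma card_nat_near:
  fixes y w :: real
  assumes "w > 0"
  shows "finite {v::nat. \<bar>real v - y\<bar> < w}" "real (card {v::nat. \<bar>real v - y\<bar> < w}) \<le> 2 * w + 1"
proof -
  let ?A = "{v::nat. \<bar>real v - y\<bar> < w}" and ?B = "{\<lceil>y - w\<rceil>..\<lfloor>y + w\<rfloor>}"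
  have sub: "int ` ?A \<subseteq> ?B"
    by (auto simp: ceiling_le_iff le_floor_iff abs_less_iff)
  then have "finite (int ` ?A)" by (rule finite_subset) simp
  then show "finite ?A" by (rule finite_imageD) (simp add: inj_on_def)
  have "card ?A = card (int ` ?A)" by (simp add: card_image inj_on_def)
  also have "\<dots> \<le> card ?B" by (rule card_mono[OF _ sub]) simp
  also have "card ?B = nat (\<lfloor>y + w\<rfloor> - \<lceil>y - w\<rceil> + 1)" by simp
  finally have "real (card ?A) \<le> real (nat (\<lfloor>y + w\<rfloor> - \<lceil>y - w\<rceil> + 1))" by simp
  also have "\<dots> \<le> 2 * w + 1"
    using assms by linarith
  finally show "real (card ?A) \<le> 2 * w + 1" .
qed

text \<open>A union bound over the at most 2 w + 1 natural numbers in the window.\<close>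

lemma prob_random_index_near_le:
  assumes "w > 0"
  shows "measure random_bits {r. \<bar>real (random_index r m) - y\<bar> < w} \<le> (2 * w + 1) / 2 ^ m"
proof -
  interpret prob_space random_bits by (rule prob_space_random_bits)
  let ?A = "{v::nat. \<bar>real v - y\<bar> < w}"
  have "measure random_bits {r. \<bar>real (random_index r m) - y\<bar> < w} =
      measure random_bits (\<Union>v\<in>?A. {r. random_index r m = v})"
    by (rule arg_cong[where f = "measure random_bits"]) auto
  also have "\<dots> \<le> (\<Sum>v\<in>?A. measure random_bits {r. random_index r m = v})"
  proof (rule finite_measure_subadditive_finite)
    have "{r \<in> space random_bits. random_index r m = v} \<in> sets random_bits" for v
      by measurable
    then show "(\<lambda>v. {r. random_index r m = v}) ` ?A \<subseteq> sets random_bits" by auto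
  qed (rule card_nat_near(1)[OF assms])
  also have "\<dots> \<le> (\<Sum>v\<in>?A. 1 / 2 ^ m)" by (intro sum_mono prob_random_index_le)
  also have "\<dots> \<le> (2 * w + 1) / 2 ^ m"
    using card_nat_near(2)[OF assms, of y] by (simp add: divide_right_mono)
  finally show ?thesis .
qed

section \<open>Runs with accurate estimates\<close>

lemma random_index_less: "random_index r m < 2 ^ m"
  by (induction m) auto

context coin_parameters
begin

definition margin :: "nat \<Rightarrow> real" where
  "margin k = (q\<^sub>0 - p\<^sub>0) / (8 * 2 ^ k)"

definition clipped_bias :: "(nat \<Rightarrow> bool) pmf \<Rightarrow> nat \<Rightarrow> real" where
  "clipped_bias D i = min (bias D i) q\<^sub>0"

text \<open>For a bias above \<open>q\<^sub>0\<close> only the lower estimate is demanded: the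
  Chernoff exponent is tuned to biases up to \<open>q\<^sub>0\<close>, and beyond that it is enough
  not to fall far below \<open>q\<^sub>0\<close>.\<close>

definition good :: "(nat \<Rightarrow> bool) pmf \<Rightarrow> samples \<Rightarrow> bool" where
  "good D S \<longleftrightarrow> (\<forall>i\<in>{1..N}. \<forall>k\<in>{..K}.
     phase_flips k * (clipped_bias D i - margin k) < heads S i (phase_flips k) \<and>
     (bias D i \<le> q\<^sub>0 \<longrightarrow> heads S i (phase_flips k) < phase_flips k * (bias D i + margin k)))"

text \<open>One margin for the error of the estimate and one for the stopping rule.\<close>

definition near :: "(nat \<Rightarrow> bool) pmf \<Rightarrow> bits \<Rightarrow> nat \<Rightarrow> nat \<Rightarrow> bool" where
  "near D r i k \<longleftrightarrow> \<bar>clipped_bias D i - threshold r\<bar> < 2 * margin k"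

text \<open>\<open>3 * phase_flips k\<close> is the number of additional flips in phase
  \<open>k + 1\<close>. The samples do not occur, so two runs with the same random bits share this
  bound.\<close>

definition flips_bound :: "(nat \<Rightarrow> bool) pmf \<Rightarrow> bits \<Rightarrow> nat" where
  "flips_bound D r = (\<Sum>i\<in>{1..N}. n\<^sub>0 + (\<Sum>k<K. 3 * phase_flips k * of_bool (near D r i k)))"

lemma margin_pos: "0 < margin k"
  using params by (simp add: margin_def)

lemma margin_le: "margin k \<le> (q\<^sub>0 - p\<^sub>0) / 8"
  unfolding margin_def using params by (intro divide_left_mono) auto

lemma threshold_bounds:
  "p\<^sub>0 + (q\<^sub>0 - p\<^sub>0) / 4 \<le> threshold r" "threshold r \<le> q\<^sub>0 - (q\<^sub>0 - p\<^sub>0) / 4"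
proof -
  define u where "u = real (random_index r K) / 2 ^ K"
  have "real (random_index r K) < 2 ^ K"
    using random_index_less[of r K] by (metis of_nat_less_numeral_power_cancel_iff)
  then have u: "0 \<le> u" "u \<le> 1" by (simp_all add: u_def)
  have t: "threshold r = p\<^sub>0 + (q\<^sub>0 - p\<^sub>0) / 4 + (q\<^sub>0 - p\<^sub>0) / 2 * u"
    by (simp add: threshold_def u_def field_simps)
  have "0 \<le> (q\<^sub>0 - p\<^sub>0) / 2 * u" "(q\<^sub>0 - p\<^sub>0) / 2 * u \<le> (q\<^sub>0 - p\<^sub>0) / 2"
    using u params by (auto intro: mult_left_le)
  then show "p\<^sub>0 + (q\<^sub>0 - p\<^sub>0) / 4 \<le> threshold r" "threshold r \<le> q\<^sub>0 - (q\<^sub>0 - p\<^sub>0) / 4"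
    unfolding t by (simp_all add: field_simps)
qed

lemma undecided_iff:
  "undecided S r i k \<longleftrightarrow>
     \<bar>heads S i (phase_flips k) - threshold r * phase_flips k\<bar> < phase_flips k * margin k"
proof -
  have p4: "(4::real) ^ k = 2 ^ k * 2 ^ k" by (simp flip: power_mult_distrib)
  have "(phase_flips k * margin k)\<^sup>2 = phase_flips k * stop_coeff"
    unfolding margin_def stop_coeff_def phase_flips_def
    by (simp add: power2_eq_square p4 field_simps)
  moreover have "0 \<le> phase_flips k * margin k" using margin_pos[of k] by simp
  ultimately show ?thesis
    unfolding undecided_def
    using abs_le_square_iff[of "phase_flips k * margin k" "heads S i (phase_flips k) - threshold r * phase_flips k"]
    by (simp add: not_le[symmetric])
qed

lemma good_lower:
  assumes "good D S" "i \<in> {1..N}" "k \<le> K"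
  shows "phase_flips k * clipped_bias D i - phase_flips k * margin k < heads S i (phase_flips k)"
  using assms unfolding good_def by (simp add: algebra_simps)

text \<open>Either alternative means that clipping leaves the bias unchanged; the first is the form
  available when the clipped bias lies below the threshold.\<close>

lemma good_upper:
  assumes "good D S" "i \<in> {1..N}" "k \<le> K" "clipped_bias D i < q\<^sub>0 \<or> bias D i \<le> q\<^sub>0"
  shows "heads S i (phase_flips k) < phase_flips k * clipped_bias D i + phase_flips k * margin k"
proof -
  have b: "bias D i \<le> q\<^sub>0" "clipped_bias D i = bias D i"
    using assms(4) by (auto simp: clipped_bias_def min_def split: if_splits)
  then show ?thesis
    using assms unfolding good_def b by (simp add: algebra_simps)
qed

text \<open>By the triangle inequality through the estimate. The upper estimate serves a clipped
  bias below the threshold, the lower estimate all others.\<close>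

lemma undecided_imp_near:
  assumes "good D S" "i \<in> {1..N}" "k \<le> K" "undecided S r i k"
  shows "near D r i k"
proof (rule ccontr)
  assume far: "\<not> near D r i k"
  let ?n = "real (phase_flips k)" and ?b = "clipped_bias D i"
  have n: "?n > 0" using phase_flips_pos by simp
  have u: "\<bar>heads S i (phase_flips k) - threshold r * ?n\<bar> < ?n * margin k"
    using assms(4) by (simp add: undecided_iff)
  show False
  proof (cases "?b < threshold r")
    case True
    \<comment> \<open>The threshold is below \<open>q\<^sub>0\<close>, so this bias is not clipped
      and has an upper estimate.\<close>
    then have "?b < q\<^sub>0" using threshold_bounds[of r] params by argo
    then have h: "heads S i (phase_flips k) < ?n * ?b + ?n * margin k"
      using assms by (intro good_upper) auto
    have "?b + 2 * margin k \<le> threshold r" using far True by (simp add: near_def)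
    then have "?n * ?b + 2 * (?n * margin k) \<le> ?n * threshold r"
      using mult_left_mono[of "?b + 2 * margin k" "threshold r" ?n] n by (simp add: algebra_simps)
    then show False using h u by (simp add: mult.commute)
  next
    case False
    have "threshold r + 2 * margin k \<le> ?b" using far False by (simp add: near_def)
    then have "?n * threshold r + 2 * (?n * margin k) \<le> ?n * ?b"
      using mult_left_mono[of "threshold r + 2 * margin k" ?b ?n] n by (simp add: algebra_simps)
    then show False using good_lower[OF assms(1-3)] u by (simp add: mult.commute)
  qed
qed

text \<open>A settled estimate is at least one margin away from the threshold, while it errs towards
  the threshold by less than one margin, so it is on the same side as the clipped bias. The
  right-hand side is free of \<open>S\<close> and \<open>k\<close>, which is the source of
  replicability.\<close>

lemma accept_iff:
  assumes "good D S" "i \<in> {1..N}" "k \<le> K" "\<not> undecided S r i k"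
  shows "threshold r * phase_flips k \<le> heads S i (phase_flips k) \<longleftrightarrow> threshold r \<le> clipped_bias D i"
proof -
  let ?n = "real (phase_flips k)" and ?b = "clipped_bias D i"
  have n: "?n > 0" using phase_flips_pos by simp
  have d: "?n * margin k \<le> \<bar>heads S i (phase_flips k) - threshold r * ?n\<bar>"
    using assms(4) by (simp add: undecided_iff)
  have m: "?n * margin k > 0" using n margin_pos by simp
  show ?thesis
  proof (cases "?b < threshold r")
    case True
    then have "?b < q\<^sub>0" using threshold_bounds[of r] params by argo
    then have h: "heads S i (phase_flips k) < ?n * ?b + ?n * margin k"
      using assms by (intro good_upper) auto
    have "?n * ?b < threshold r * ?n" using True n by (simp add: mult.commute)
    then show ?thesis using h d m True by linarith
  next
    case False
    then have "threshold r * ?n \<le> ?n * ?b" using n by (simp add: mult.commute)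
    then show ?thesis using good_lower[OF assms(1-3)] d m False by linarith
  qed
qed

text \<open>The threshold keeps distance \<open>(q\<^sub>0 - p\<^sub>0) / 4\<close> from both ends
  and margins are at most half of that. Hence this lemma and the next hold in every phase, settled
  or not, and correctness survives an exhausted budget.\<close>

lemma reject_small_bias:
  assumes "good D S" "i \<in> {1..N}" "k \<le> K" "bias D i \<le> p\<^sub>0"
  shows "heads S i (phase_flips k) < threshold r * phase_flips k"
proof -
  let ?n = "real (phase_flips k)"
  have n: "?n > 0" using phase_flips_pos by simp
  have b: "clipped_bias D i = bias D i" "bias D i \<le> q\<^sub>0" using assms params by (auto simp: clipped_bias_def)
  have "heads S i (phase_flips k) < ?n * clipped_bias D i + ?n * margin k"
    using assms b by (intro good_upper) auto
  also have "\<dots> = ?n * (bias D i + margin k)" by (simp add: b algebra_simps)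
  also have "bias D i + margin k \<le> threshold r"
    using assms(4) threshold_bounds(1)[of r] margin_le[of k] params(2) by argo
  then have "?n * (bias D i + margin k) \<le> ?n * threshold r"
    using n by (intro mult_left_mono) auto
  finally show ?thesis by (simp add: mult.commute)
qed

lemma accept_large_bias:
  assumes "good D S" "i \<in> {1..N}" "k \<le> K" "q\<^sub>0 \<le> bias D i"
  shows "threshold r * phase_flips k \<le> heads S i (phase_flips k)"
proof -
  let ?n = "real (phase_flips k)"
  have n: "?n > 0" using phase_flips_pos by simp
  have b: "clipped_bias D i = q\<^sub>0" using assms by (auto simp: clipped_bias_def)
  have "threshold r \<le> q\<^sub>0 - margin k"
    using threshold_bounds(2)[of r] margin_le[of k] params(2) by argo
  then have "?n * threshold r \<le> ?n * (q\<^sub>0 - margin k)" using n by (intro mult_left_mono) auto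
  also have "\<dots> = ?n * clipped_bias D i - ?n * margin k" by (simp add: b algebra_simps)
  also have "\<dots> < heads S i (phase_flips k)" using assms by (intro good_lower) auto
  finally show ?thesis by (simp add: mult.commute)
qed

lemma phase_flips_eq: "phase_flips \<kappa> = n\<^sub>0 + (\<Sum>k<\<kappa>. 3 * phase_flips k)"
  by (induction \<kappa>) (simp_all add: phase_flips_def)

text \<open>A phase after the first is entered only from an undecided, hence near, phase; the
  telescoping sum \<open>phase_flips_eq\<close> charges its flips to the phase just left.\<close>

lemma total_flips_le_flips_bound:
  assumes "good D S"
  shows "total_flips S r \<le> flips_bound D r"
proof -
  obtain \<kappa> where \<kappa>: "\<And>i. i \<in> {1..N} \<Longrightarrow> \<kappa> i \<le> K"
    "\<And>i k. i \<in> {1..N} \<Longrightarrow> k < \<kappa> i \<Longrightarrow> undecided S r i k"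
    "total_flips S r = (\<Sum>i\<in>{1..N}. phase_flips (\<kappa> i))"
    by (rule coin_program_spec[of S r]) blast
  show ?thesis
    unfolding \<kappa>(3) flips_bound_def
  proof (rule sum_mono)
    fix i assume i: "i \<in> {1..N}"
    have "(\<Sum>k<\<kappa> i. 3 * phase_flips k) = (\<Sum>k<\<kappa> i. 3 * phase_flips k * of_bool (near D r i k))"
      using \<kappa>(1)[OF i] undecided_imp_near[OF assms i] \<kappa>(2)[OF i] by (intro sum.cong) auto
    also have "\<dots> \<le> (\<Sum>k<K. 3 * phase_flips k * of_bool (near D r i k))"
      using \<kappa>(1)[OF i] by (intro sum_mono2) auto
    finally show "phase_flips (\<kappa> i) \<le> n\<^sub>0 + (\<Sum>k<K. 3 * phase_flips k * of_bool (near D r i k))"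
      by (subst phase_flips_eq) simp
  qed
qed

text \<open>With the bound below the budget, the budget is never reached, so every coin ends settled
  and \<open>accept_iff\<close> applies.\<close>

lemma output_eq:
  assumes "good D S" "flips_bound D r < phase_flips K"
  shows "output S r = {i\<in>{1..N}. threshold r \<le> clipped_bias D i}"
proof -
  obtain \<kappa> where \<kappa>: "\<And>i. i \<in> {1..N} \<Longrightarrow> \<kappa> i \<le> K"
    "\<And>i. i \<in> {1..N} \<Longrightarrow> undecided S r i (\<kappa> i) \<Longrightarrow> phase_flips K \<le> total_flips S r"
    "output S r = {i\<in>{1..N}. threshold r * phase_flips (\<kappa> i) \<le> heads S i (phase_flips (\<kappa> i))}"
    by (rule coin_program_spec[of S r]) blast
  have "\<not> undecided S r i (\<kappa> i)" if "i \<in> {1..N}" for i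
    using \<kappa>(2)[OF that] total_flips_le_flips_bound[OF assms(1), of r] assms(2) by linarith
  then show ?thesis
    unfolding \<kappa>(3) using accept_iff[OF assms(1)] \<kappa>(1) by blast
qed

lemma output_subset: "output S r \<subseteq> {1..N}"
  by (rule coin_program_spec[of S r]) auto

lemma output_correct:
  assumes "good D S" "i \<in> {1..N}"
  shows "bias D i \<le> p\<^sub>0 \<Longrightarrow> i \<notin> output S r" "q\<^sub>0 \<le> bias D i \<Longrightarrow> i \<in> output S r"
proof -
  obtain \<kappa> where \<kappa>: "\<And>i. i \<in> {1..N} \<Longrightarrow> \<kappa> i \<le> K"
    "output S r = {i\<in>{1..N}. threshold r * phase_flips (\<kappa> i) \<le> heads S i (phase_flips (\<kappa> i))}"
    by (rule coin_program_spec[of S r]) blast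
  show "bias D i \<le> p\<^sub>0 \<Longrightarrow> i \<notin> output S r"
    using reject_small_bias[OF assms \<kappa>(1)[OF assms(2)], of r] by (auto simp: \<kappa>(2))
  show "q\<^sub>0 \<le> bias D i \<Longrightarrow> i \<in> output S r"
    using accept_large_bias[OF assms \<kappa>(1)[OF assms(2)], of r] assms(2) by (auto simp: \<kappa>(2))
qed

end

section \<open>Probability estimates\<close>

context coin_parameters
begin

text \<open>\<open>K\<close> is the least exponent with \<open>24 * N / \<rho> \<le> 2 ^ K\<close>,
  hence sharp up to a factor 2. The third bound uses \<open>4 * \<delta> < \<rho>\<close>; it lets
  inaccurate runs, charged the full budget, fit into the expected cost.\<close>

lemma two_power_K: "24 * N \<le> \<rho> * 2 ^ K" "\<rho> * 2 ^ K < 48 * N" "\<delta> * 2 ^ K < 12 * N" "real N \<le> 2 ^ K"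
proof -
  have \<rho>: "\<rho> > 0" using params by simp
  show 1: "24 * N \<le> \<rho> * 2 ^ K"
    using K_iff[of K] \<rho> by (simp add: not_less field_simps)
  have "2 ^ (K - 1) < 24 * real N / \<rho>" using K_iff[of "K - 1"] K_pos by simp
  moreover have "(2::real) ^ K = 2 * 2 ^ (K - 1)" using K_pos by (cases K) auto
  ultimately show 2: "\<rho> * 2 ^ K < 48 * N" using \<rho> by (simp add: field_simps)
  have "(4 * \<delta>) * 2 ^ K \<le> \<rho> * 2 ^ K" using params by (intro mult_right_mono) auto
  with 2 show "\<delta> * 2 ^ K < 12 * N" unfolding mult.assoc by linarith
  have "\<rho> * 2 ^ K \<le> 24 * 2 ^ K" using params by (intro mult_right_mono) auto
  with 1 have "24 * real N \<le> 24 * 2 ^ K" by linarith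
  then show "real N \<le> 2 ^ K" by linarith
qed

lemma N_le_two_power_K: "N \<le> 2 ^ K"
  using two_power_K(4) by (metis of_nat_le_iff of_nat_numeral of_nat_power)

lemma exp_l: "exp (- real l) \<le> \<delta> / N"
proof -
  have "real N / \<delta> \<le> 2 ^ l" using l_iff[of l] by simp
  also have "(2::real) ^ l \<le> exp 1 ^ l"
    using exp_ge_add_one_self[of 1] by (intro power_mono) auto
  also have "\<dots> = exp (real l)" by (simp flip: exp_of_nat_mult)
  finally show ?thesis
    using params N_ge_1 by (simp add: exp_minus field_simps)
qed

text \<open>The Chernoff exponent is the same in all phases. Here 1024 = 64 * 4 * 4: 64 from the
  margin, one 4 from the Chernoff exponent, and one for the fourth power of
  \<open>\<delta> / N\<close>.\<close>

lemma phase_deviation: "phase_flips k * (margin k)\<^sup>2 / (4 * q\<^sub>0) \<ge> 4 * real l"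
proof -
  have p4: "(4::real) ^ k = 2 ^ k * 2 ^ k" by (simp flip: power_mult_distrib)
  have "phase_flips k * (margin k)\<^sup>2 = n\<^sub>0 * (q\<^sub>0 - p\<^sub>0)\<^sup>2 / 64"
    unfolding margin_def phase_flips_def by (simp add: power2_eq_square p4 field_simps)
  moreover have "1024 * q\<^sub>0 * real l \<le> n\<^sub>0 * (q\<^sub>0 - p\<^sub>0)\<^sup>2"
    using n0_lower params by (simp add: divide_le_eq)
  ultimately have "16 * (q\<^sub>0 * real l) \<le> phase_flips k * (margin k)\<^sup>2" by linarith
  then show ?thesis using params by (simp add: le_divide_eq mult_ac)
qed

lemma prob_phase_le:
  shows "measure (iid_samples D) {S. heads S i (phase_flips k) \<le> phase_flips k * (clipped_bias D i - margin k)}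
      \<le> (\<delta> / N) ^ 4" (is ?lower)
    and "bias D i \<le> q\<^sub>0 \<Longrightarrow>
      measure (iid_samples D) {S. phase_flips k * (bias D i + margin k) \<le> heads S i (phase_flips k)}
      \<le> (\<delta> / N) ^ 4" (is "_ \<Longrightarrow> ?upper")
proof -
  have "exp (- (phase_flips k * (margin k)\<^sup>2 / (4 * q\<^sub>0))) \<le> exp (- (4 * real l))"
    using phase_deviation[of k] by simp
  also have "exp (- (4 * real l)) = exp (- real l) ^ 4" by (simp flip: exp_of_nat_mult)
  also have "\<dots> \<le> (\<delta> / N) ^ 4" using exp_l by (intro power_mono) auto
  finally have e: "exp (- (phase_flips k * (margin k)\<^sup>2 / (4 * q\<^sub>0))) \<le> (\<delta> / N) ^ 4" .
  have m: "margin k \<le> 2 * q\<^sub>0" using margin_le[of k] params by argo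
  show ?lower
    using chernoff_lower[of q\<^sub>0 "margin k" D i "phase_flips k"] e m margin_pos params
    unfolding clipped_bias_def by simp
  show ?upper if "bias D i \<le> q\<^sub>0"
    using chernoff_upper[of D i q\<^sub>0 "margin k" "phase_flips k"] e m margin_pos that by simp
qed

lemma sets_good [measurable]: "{S. good D S} \<in> sets (iid_samples D)"
proof -
  have "{S \<in> space (iid_samples D). good D S} \<in> sets (iid_samples D)"
    unfolding good_def by measurable
  then show ?thesis by simp
qed

text \<open>A union bound over 2 N (K + 1) events. As K + 1 \<le> 2^K < 12 N / \<delta>, the fourth
  power of \<open>\<delta> / N\<close> leaves at most 24 \<delta>^3 / N^2.\<close>

lemma prob_not_good: "measure (iid_samples D) {S. \<not> good D S} < \<delta>"
proof -
  interpret prob_space "iid_samples D" by (rule prob_space_iid_samples)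
  let ?L = "\<lambda>i k. {S. heads S i (phase_flips k) \<le> phase_flips k * (clipped_bias D i - margin k)}"
  let ?U = "\<lambda>i k. {S. bias D i \<le> q\<^sub>0 \<and> phase_flips k * (bias D i + margin k) \<le> heads S i (phase_flips k)}"
  have meas: "?L i k \<in> events" "?U i k \<in> events" for i k
  proof -
    have "{S \<in> space (iid_samples D). heads S i (phase_flips k) \<le> phase_flips k * (clipped_bias D i - margin k)} \<in> events"
      by measurable
    then show "?L i k \<in> events" by simp
    have "{S \<in> space (iid_samples D). bias D i \<le> q\<^sub>0 \<and> phase_flips k * (bias D i + margin k) \<le> heads S i (phase_flips k)} \<in> events"
      by measurable
    then show "?U i k \<in> events" by simp
  qed
  have "prob {S. \<not> good D S} = prob (\<Union>i\<in>{1..N}. \<Union>k\<in>{..K}. ?L i k \<union> ?U i k)"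
    unfolding good_def by (rule arg_cong[where f = prob]) (auto simp: not_less)
  also have "\<dots> \<le> (\<Sum>i\<in>{1..N}. prob (\<Union>k\<in>{..K}. ?L i k \<union> ?U i k))"
    using meas by (intro finite_measure_subadditive_finite) auto
  also have "\<dots> \<le> (\<Sum>i\<in>{1..N}. \<Sum>k\<in>{..K}. prob (?L i k \<union> ?U i k))"
    using meas by (intro sum_mono finite_measure_subadditive_finite) auto
  also have "\<dots> \<le> (\<Sum>i\<in>{1..N}. \<Sum>k\<in>{..K}. 2 * (\<delta> / N) ^ 4)"
  proof (intro sum_mono)
    fix i k
    have "prob (?U i k) \<le> (\<delta> / N) ^ 4"
      using prob_phase_le(2)[of D i k] by (cases "bias D i \<le> q\<^sub>0") auto
    then show "prob (?L i k \<union> ?U i k) \<le> 2 * (\<delta> / N) ^ 4"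
      using measure_Un_le[OF meas, of i k i k] prob_phase_le(1)[of D i k] by linarith
  qed
  also have "\<dots> = 2 * real N * real (Suc K) * (\<delta> / N) ^ 4" by simp
  also have "\<dots> \<le> 2 * real N * 2 ^ K * (\<delta> / N) ^ 4"
  proof -
    have "Suc K \<le> 2 ^ K" by (rule Suc_leI[OF less_exp])
    then have "real (Suc K) \<le> 2 ^ K" by (metis of_nat_le_iff of_nat_numeral of_nat_power)
    then show ?thesis by (intro mult_right_mono mult_left_mono) auto
  qed
  also have "\<dots> = (\<delta> * 2 ^ K) * (2 * \<delta> ^ 3 / N ^ 3)"
    using N_ge_1 by (simp add: field_simps power_numeral_reduce)
  also have "\<dots> \<le> (12 * N) * (2 * \<delta> ^ 3 / N ^ 3)"
    using two_power_K(3) params by (intro mult_right_mono) auto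
  also have "\<dots> = 24 * \<delta> ^ 3 / N\<^sup>2" using N_ge_1 by (simp add: field_simps power_numeral_reduce)
  also have "\<dots> \<le> 24 * \<delta> ^ 3 / 1"
    using N_ge_1 params by (intro divide_left_mono) auto
  also have "\<dots> = 24 * \<delta>\<^sup>2 * \<delta>" by (simp add: power_numeral_reduce)
  also have "\<dots> < 1 * \<delta>"
  proof (rule mult_strict_right_mono)
    \<comment> \<open>From \<open>4 * \<delta> < \<rho>\<close> and \<open>\<rho> < 1 / 2\<close>;
      then 24 / 64 < 1.\<close>
    have "\<delta>\<^sup>2 < (1 / 8)\<^sup>2" using params by (intro power_strict_mono) auto
    then show "24 * \<delta>\<^sup>2 < 1" by (simp add: power2_eq_square)
  qed (use params in simp)
  finally show ?thesis by simp
qed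

section \<open>Expected number of flips over the random threshold\<close>

lemma measurable_near [measurable]: "Measurable.pred random_bits (\<lambda>r. near D r i k)"
  unfolding near_def threshold_def by measurable

lemma prob_near_le:
  assumes "k \<le> K"
  shows "measure random_bits {r. near D r i k} \<le> 2 / 2 ^ k"
proof -
  \<comment> \<open>\<open>y\<close> and \<open>w\<close> express the clipped bias and
    \<open>2 * margin k\<close> in grid units of the threshold; the grid spacing is
    \<open>?c\<close> below.\<close>
  define y where "y = (4 * (clipped_bias D i - p\<^sub>0) / (q\<^sub>0 - p\<^sub>0) - 1) * 2 ^ K / 2"
  define w :: real where "w = 2 ^ K / (2 * 2 ^ k)"
  have e: "q\<^sub>0 - p\<^sub>0 > 0" using params by simp
  have "near D r i k \<longleftrightarrow> \<bar>real (random_index r K) - y\<bar> < w" for r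
  proof -
    let ?c = "(q\<^sub>0 - p\<^sub>0) / (2 * 2 ^ K)"
    have c: "?c > 0" using e by simp
    have "threshold r - clipped_bias D i = ?c * (real (random_index r K) - y)"
      using e unfolding threshold_def y_def by (simp add: field_simps)
    then have "\<bar>clipped_bias D i - threshold r\<bar> = ?c * \<bar>real (random_index r K) - y\<bar>"
      using c e by (simp add: abs_minus_commute[of "clipped_bias D i"] abs_mult)
    moreover have "2 * margin k = ?c * w" using e unfolding margin_def w_def by (simp add: field_simps)
    ultimately show ?thesis unfolding near_def using mult_less_cancel_left_pos[OF c] by simp
  qed
  then have "measure random_bits {r. near D r i k} \<le> (2 * w + 1) / 2 ^ K"
    using prob_random_index_near_le[of w K y] by (simp add: w_def)
  \<comment> \<open>As \<open>k \<le> K\<close>, the grid is fine enough to absorb the 1 that comes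
    from counting grid points.\<close>
  also have "\<dots> \<le> (2 * w + 2 ^ K / 2 ^ k) / 2 ^ K"
    using assms by (intro divide_right_mono add_left_mono) (simp_all add: power_increasing)
  also have "\<dots> = 2 / 2 ^ k" by (simp add: w_def field_simps)
  finally show ?thesis .
qed

lemma measurable_flips_bound [measurable]: "flips_bound D \<in> measurable random_bits (count_space UNIV)"
  unfolding flips_bound_def by measurable

text \<open>The \<open>3 * phase_flips k\<close> flips are counted with probability at most 2 / 2^k,
  so index \<open>k\<close> contributes at most \<open>6 * n\<^sub>0 * 2 ^ k\<close> per coin, and
  the geometric sum is of the order of its last term.\<close>

lemma integral_flips_bound_le:
  "(\<integral>\<^sup>+ r. of_nat (flips_bound D r) \<partial>random_bits) \<le> ennreal (6 * N * n\<^sub>0 * 2 ^ K)"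
proof -
  interpret prob_space random_bits by (rule prob_space_random_bits)
  have int: "integrable random_bits (\<lambda>r. real (of_bool (near D r i k)))" for i k
    by (intro integrable_const_bound[where B = 1]) auto
  have "(\<integral>r. real (of_bool (near D r i k)) \<partial>random_bits) = prob {r. near D r i k}" for i k
  proof -
    have "(\<integral>r. real (of_bool (near D r i k)) \<partial>random_bits) = (\<integral>r. indicator {r. near D r i k} r \<partial>random_bits)"
      by (intro Bochner_Integration.integral_cong) auto
    then show ?thesis by simp
  qed
  then have near: "(\<integral>r. real (of_bool (near D r i k)) \<partial>random_bits) \<le> 2 / 2 ^ k" if "k < K" for i k
    using prob_near_le[of k D i] that by simp
  have eq: "real (flips_bound D r) =
      (\<Sum>i\<in>{1..N}. n\<^sub>0 + (\<Sum>k<K. 3 * phase_flips k * real (of_bool (near D r i k))))" for r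
    unfolding flips_bound_def by (simp only: of_nat_sum of_nat_add of_nat_mult of_nat_numeral of_nat_of_bool)
  have int': "integrable random_bits (\<lambda>r. real (flips_bound D r))"
    unfolding eq using int by (intro Bochner_Integration.integrable_sum Bochner_Integration.integrable_add integrable_mult_right) auto
  have "(\<integral>\<^sup>+ r. of_nat (flips_bound D r) \<partial>random_bits) = (\<integral>\<^sup>+ r. ennreal (real (flips_bound D r)) \<partial>random_bits)"
    by (simp add: ennreal_of_nat_eq_real_of_nat)
  also have "\<dots> = ennreal (\<integral>r. real (flips_bound D r) \<partial>random_bits)"
    by (intro nn_integral_eq_integral int') auto
  finally have int_eq: "(\<integral>\<^sup>+ r. of_nat (flips_bound D r) \<partial>random_bits) =
      ennreal (\<integral>r. real (flips_bound D r) \<partial>random_bits)" .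
  have "(\<integral>r. real (flips_bound D r) \<partial>random_bits) =
      (\<Sum>i\<in>{1..N}. n\<^sub>0 + (\<Sum>k<K. 3 * phase_flips k * (\<integral>r. real (of_bool (near D r i k)) \<partial>random_bits)))"
    unfolding eq using int by (simp add: integral_sum prob_space[simplified] del: of_nat_of_bool sum_mult_of_bool_eq)
  also have "\<dots> \<le> (\<Sum>i\<in>{1..N}. n\<^sub>0 + (\<Sum>k<K. 3 * phase_flips k * (2 / 2 ^ k)))"
    using near by (intro sum_mono add_left_mono mult_left_mono) auto
  also have "(\<Sum>k<K. 3 * phase_flips k * (2 / 2 ^ k)) = 6 * real n\<^sub>0 * (\<Sum>k<K. 2 ^ k)"
  proof -
    have p4: "(4::real) ^ k = 2 ^ k * 2 ^ k" for k by (simp flip: power_mult_distrib)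
    show ?thesis
      unfolding sum_distrib_left by (intro sum.cong) (simp_all add: phase_flips_def p4)
  qed
  also have "(\<Sum>k<K. 2 ^ k) = (2::real) ^ K - 1" using sum_power2[of K] by (simp add: geometric_sum)
  also have "(\<Sum>i\<in>{1..N}. real n\<^sub>0 + 6 * real n\<^sub>0 * (2 ^ K - 1)) = real N * n\<^sub>0 * (6 * 2 ^ K - 5)"
    by (simp add: algebra_simps)
  also have "\<dots> \<le> real N * n\<^sub>0 * (6 * 2 ^ K)" by (intro mult_left_mono) auto
  finally show ?thesis unfolding int_eq by (intro ennreal_leI) (simp add: mult_ac)
qed

text \<open>Markov's inequality: the mean divided by the budget is at most 6 N / 2^K, and
  \<open>K\<close> was chosen to make this at most \<open>\<rho> / 4\<close>.\<close>

lemma prob_flips_bound_ge: "measure random_bits {r. phase_flips K \<le> flips_bound D r} \<le> \<rho> / 4"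
proof -
  interpret prob_space random_bits by (rule prob_space_random_bits)
  let ?c = "1 / real (phase_flips K)"
  have B: "real (phase_flips K) = n\<^sub>0 * 2 ^ K * 2 ^ K"
    by (simp add: phase_flips_def flip: power_mult_distrib)
  have n: "real n\<^sub>0 > 0" "real (phase_flips K) > 0" using n0_pos phase_flips_pos by simp_all
  have "emeasure random_bits {r. phase_flips K \<le> flips_bound D r} \<le>
      emeasure random_bits {r \<in> space random_bits. 1 \<le> ennreal ?c * of_nat (flips_bound D r)}"
  proof (rule emeasure_mono)
    have "1 \<le> ennreal ?c * of_nat (flips_bound D r)" if "phase_flips K \<le> flips_bound D r" for r
    proof -
      have "1 \<le> ?c * real (flips_bound D r)" using that n by (simp add: field_simps)
      then have "ennreal 1 \<le> ennreal (?c * real (flips_bound D r))" by (rule ennreal_leI)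
      also have "ennreal (?c * real (flips_bound D r)) = ennreal ?c * of_nat (flips_bound D r)"
        unfolding ennreal_of_nat_eq_real_of_nat by (rule ennreal_mult) auto
      finally show ?thesis by simp
    qed
    then show "{r. phase_flips K \<le> flips_bound D r} \<subseteq>
        {r \<in> space random_bits. 1 \<le> ennreal ?c * of_nat (flips_bound D r)}" by auto
  qed measurable
  also have "\<dots> \<le> ennreal ?c * (\<integral>\<^sup>+ r. of_nat (flips_bound D r) * indicator (space random_bits) r \<partial>random_bits)"
    by (rule nn_integral_Markov_inequality) (use sets.top[of random_bits] in auto)
  also have "\<dots> \<le> ennreal ?c * ennreal (6 * N * n\<^sub>0 * 2 ^ K)"
    using integral_flips_bound_le[of D] by (intro mult_left_mono) auto
  also have "\<dots> = ennreal (?c * (6 * N * n\<^sub>0 * 2 ^ K))" by (rule ennreal_mult[symmetric]) auto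
  also have "?c * (6 * N * n\<^sub>0 * 2 ^ K) = 6 * N / 2 ^ K"
    unfolding B using n by (simp add: field_simps)
  also have "\<dots> \<le> \<rho> / 4" using two_power_K(1) by (simp add: field_simps)
  finally show ?thesis
    using params by (simp add: emeasure_eq_measure ennreal_leI)
qed

end

section \<open>Replicability, correctness and cost\<close>

lemma measure_vimage_fst:
  assumes "prob_space M" "prob_space M'" "A \<in> sets M"
  shows "measure (M \<Otimes>\<^sub>M M') {x \<in> space (M \<Otimes>\<^sub>M M'). fst x \<in> A} = measure M A"
proof -
  interpret M: prob_space M by fact
  interpret M': prob_space M' by fact
  have "{x \<in> space (M \<Otimes>\<^sub>M M'). fst x \<in> A} = A \<times> space M'"
    using sets.sets_into_space[OF assms(3)] by (auto simp: space_pair_measure)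
  then show ?thesis
    using assms(3) by (simp add: measure_def M'.emeasure_pair_measure_Times M'.emeasure_space_1)
qed

lemma measure_vimage_snd:
  assumes "prob_space M" "prob_space M'" "A \<in> sets M'"
  shows "measure (M \<Otimes>\<^sub>M M') {x \<in> space (M \<Otimes>\<^sub>M M'). snd x \<in> A} = measure M' A"
proof -
  interpret M: prob_space M by fact
  interpret M': prob_space M' by fact
  have "{x \<in> space (M \<Otimes>\<^sub>M M'). snd x \<in> A} = space M \<times> A"
    using sets.sets_into_space[OF assms(3)] by (auto simp: space_pair_measure)
  then show ?thesis
    using assms(3) by (simp add: measure_def M'.emeasure_pair_measure_Times M.emeasure_space_1)
qed

context coin_parameters
begin

definition max_time :: nat where
  "max_time = 40 * (4 * phase_flips K + N * n\<^sub>0) + 4 * l + 2 * n\<^sub>0 + 6 * K + 61"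

lemma output_cong:
  assumes "\<And>k i. i \<in> {1..N} \<Longrightarrow> k < max_time \<Longrightarrow> S' k i = S k i"
    and "\<And>j. j < max_time \<Longrightarrow> r' j = r j"
  shows "output S' r' = output S r"
proof -
  let ?t = "running_time coin_program N start S r" and ?s = "final_state coin_program N start S r"
  have "?t \<le> max_time"
    using running_time_le[of S r] total_flips_le[of S r] unfolding max_time_def add_mult_distrib2 by linarith
  moreover have "flips ?s i \<le> ?t" "tosses ?s \<le> ?t" for i
    using exec_bounds[OF exec_final_state[of S r], of i] by (simp_all add: initial_state_def)
  ultimately have "exec N S' r' coin_program start ?t ?s"
    using assms by (intro exec_cong[OF exec_final_state]) (meson order.strict_trans2)+
  then have "final_state coin_program N start S' r' = ?s"
    using exec_deterministic exec_final_state by blast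
  then show ?thesis by (simp add: coin_output_def)
qed

text \<open>Allows \<open>replicable_output\<close> to pass to the complement. By
  \<open>output_cong\<close> the event depends on finitely many bits: \<open>Inl\<close> indexes the
  internal ones, the two kinds of \<open>Inr\<close> those of the two sample sets.\<close>

lemma sets_replicable:
  "{(r, S, S'). output S r = output S' r} \<in> sets (random_bits \<Otimes>\<^sub>M (iid_samples D \<Otimes>\<^sub>M iid_samples D))"
proof -
  let ?M = "random_bits \<Otimes>\<^sub>M (iid_samples D \<Otimes>\<^sub>M iid_samples D)"
  let ?I = "{..<max_time} \<times> {1..N}"
  let ?P = "\<lambda>j x. case j of Inl j \<Rightarrow> fst x j
    | Inr (Inl (k, i)) \<Rightarrow> fst (snd x) k i | Inr (Inr (k, i)) \<Rightarrow> snd (snd x) k i"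
  have sp: "space ?M = UNIV" by (simp add: space_pair_measure)
  have "{x \<in> space ?M. output (fst (snd x)) (fst x) = output (snd (snd x)) (fst x)} \<in> sets ?M"
  proof (rule pred_finite_dependence[where J = "{..<max_time} <+> ?I <+> ?I" and P = ?P])
    show "finite ({..<max_time} <+> ?I <+> ?I)" by simp
  next
    have [measurable]: "{x \<in> space ?M. fst x j} \<in> sets ?M"
      "{x \<in> space ?M. fst (snd x) k i} \<in> sets ?M" "{x \<in> space ?M. snd (snd x) k i} \<in> sets ?M" for j k i
      by measurable
    fix j show "{x \<in> space ?M. ?P j x} \<in> sets ?M"
    proof (cases j)
      case (Inr j')
      then show ?thesis by (cases j') (simp_all add: split_beta)
    qed simp
  next
    fix x y :: "bits \<times> samples \<times> samples"
    assume *: "\<And>j. j \<in> {..<max_time} <+> ?I <+> ?I \<Longrightarrow> ?P j x \<longleftrightarrow> ?P j y"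
      and eq: "output (fst (snd x)) (fst x) = output (snd (snd x)) (fst x)"
    have "fst y j = fst x j" if "j < max_time" for j using *[of "Inl j"] that by auto
    moreover have "fst (snd y) k i = fst (snd x) k i" "snd (snd y) k i = snd (snd x) k i"
      if "i \<in> {1..N}" "k < max_time" for k i
    proof -
      have ki: "(k, i) \<in> ?I" using that by simp
      show "fst (snd y) k i = fst (snd x) k i" using *[OF InrI[OF InlI[OF ki]]] by simp
      show "snd (snd y) k i = snd (snd x) k i" using *[OF InrI[OF InrI[OF ki]]] by simp
    qed
    ultimately have "output (fst (snd y)) (fst y) = output (fst (snd x)) (fst x)"
      "output (snd (snd y)) (fst y) = output (snd (snd x)) (fst x)"
      by (auto intro!: output_cong)
    with eq show "output (fst (snd y)) (fst y) = output (snd (snd y)) (fst y)" by simp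
  qed
  then show ?thesis by (simp add: sp case_prod_unfold)
qed

lemma sets_not_good [measurable]: "{S. \<not> good D S} \<in> sets (iid_samples D)"
proof -
  have "space (iid_samples D) - {S. good D S} \<in> sets (iid_samples D)" by measurable
  then show ?thesis by (simp add: Compl_eq_Diff_UNIV[symmetric] Collect_neg_eq)
qed

text \<open>Both runs yield the set in \<open>output_eq\<close>, which is fixed by \<open>r\<close>
  and \<open>D\<close>, unless the flip bound reaches the budget (at most \<open>\<rho> / 4\<close>)
  or \<open>S\<close> or \<open>S'\<close> is inaccurate (less than \<open>\<delta>\<close> each);
  in total this is below \<open>\<rho>\<close>.\<close>

lemma replicable_output: "replicable \<rho> output"
  unfolding replicable_def
proof
  fix D
  let ?I = "iid_samples D"
  let ?M = "random_bits \<Otimes>\<^sub>M (?I \<Otimes>\<^sub>M ?I)"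
  let ?E = "{(r, S, S'). output S r = output S' r}"
  let ?T = "{r. phase_flips K \<le> flips_bound D r}" and ?G = "{S. \<not> good D S}"
  note ps = prob_space_random_bits prob_space_iid_samples
  interpret I2: pair_prob_space ?I ?I
    using ps by (simp add: pair_prob_space_def pair_sigma_finite_def prob_space_imp_sigma_finite)
  interpret M: pair_prob_space random_bits "?I \<Otimes>\<^sub>M ?I"
    using ps I2.prob_space_axioms
    by (simp add: pair_prob_space_def pair_sigma_finite_def prob_space_imp_sigma_finite)
  have sp: "space ?M = UNIV" "space (?I \<Otimes>\<^sub>M ?I) = UNIV" by (simp_all add: space_pair_measure)
  have T: "?T \<in> sets random_bits"
  proof -
    have "{r \<in> space random_bits. phase_flips K \<le> flips_bound D r} \<in> sets random_bits" by measurable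
    then show ?thesis by simp
  qed
  have G: "?G \<in> sets ?I" by (rule sets_not_good)
  have meas: "{x \<in> space ?M. fst x \<in> ?T} \<in> sets ?M" "{x \<in> space (?I \<Otimes>\<^sub>M ?I). fst x \<in> ?G} \<in> sets (?I \<Otimes>\<^sub>M ?I)"
    "{x \<in> space (?I \<Otimes>\<^sub>M ?I). snd x \<in> ?G} \<in> sets (?I \<Otimes>\<^sub>M ?I)"
    using T G by measurable
  let ?A = "{x \<in> space ?M. fst x \<in> ?T}"
  let ?B = "{x \<in> space ?M. snd x \<in> {x \<in> space (?I \<Otimes>\<^sub>M ?I). fst x \<in> ?G}}"
  let ?C = "{x \<in> space ?M. snd x \<in> {x \<in> space (?I \<Otimes>\<^sub>M ?I). snd x \<in> ?G}}"
  have BC: "?B \<in> sets ?M" "?C \<in> sets ?M" using meas by measurable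
  have "M.prob (space ?M - ?E) \<le> M.prob (?A \<union> (?B \<union> ?C))"
  proof (rule M.finite_measure_mono)
    show "space ?M - ?E \<subseteq> ?A \<union> (?B \<union> ?C)"
    proof
      fix x assume x: "x \<in> space ?M - ?E"
      obtain r S S' where [simp]: "x = (r, S, S')" by (cases x) auto
      have "\<not> (good D S \<and> good D S' \<and> flips_bound D r < phase_flips K)"
        using x output_eq[of D S r] output_eq[of D S' r] by auto
      then show "x \<in> ?A \<union> (?B \<union> ?C)" using sp by auto
    qed
  qed (use meas BC in auto)
  also have "\<dots> \<le> M.prob ?A + M.prob (?B \<union> ?C)"
    using meas BC by (intro measure_Un_le) auto
  also have "M.prob (?B \<union> ?C) \<le> M.prob ?B + M.prob ?C"
    using BC by (intro measure_Un_le) auto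
  also have "M.prob ?A = measure random_bits ?T"
    using ps I2.prob_space_axioms T by (intro measure_vimage_fst) auto
  also have "M.prob ?B = measure ?I ?G"
    using measure_vimage_snd[OF ps(1) I2.prob_space_axioms meas(2)] measure_vimage_fst[OF ps(2) ps(2) G] by simp
  also have "M.prob ?C = measure ?I ?G"
    using measure_vimage_snd[OF ps(1) I2.prob_space_axioms meas(3)] measure_vimage_snd[OF ps(2) ps(2) G] by simp
  finally have "M.prob (space ?M - ?E) \<le> \<rho>"
    using prob_flips_bound_ge[of D] prob_not_good[of D] params by simp
  moreover have "M.prob (space ?M - ?E) = 1 - M.prob ?E"
    by (rule M.prob_compl[OF sets_replicable])
  ultimately show "1 - \<rho> \<le> M.prob ?E" by linarith
qed

lemma solves_output: "solves_coin_problem N p\<^sub>0 q\<^sub>0 \<delta> output"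
  unfolding solves_coin_problem_def
proof (intro conjI allI)
  show "output S r \<subseteq> {1..N}" for S r by (rule output_subset)
next
  fix D
  let ?M = "random_bits \<Otimes>\<^sub>M iid_samples D"
  note ps = prob_space_random_bits prob_space_iid_samples
  interpret M: pair_prob_space random_bits "iid_samples D"
    using ps by (simp add: pair_prob_space_def pair_sigma_finite_def prob_space_imp_sigma_finite)
  let ?G = "{x \<in> space ?M. snd x \<in> {S. \<not> good D S}}"
  have "M.prob {(r, S). \<exists>i\<in>{1..N}. (bias D i \<le> p\<^sub>0 \<and> i \<in> output S r) \<or> (q\<^sub>0 \<le> bias D i \<and> i \<notin> output S r)}
      \<le> M.prob ?G"
  proof (rule M.finite_measure_mono)
    show "?G \<in> sets ?M" using sets_not_good[of D] by measurable
    show "{(r, S). \<exists>i\<in>{1..N}. (bias D i \<le> p\<^sub>0 \<and> i \<in> output S r) \<or> (q\<^sub>0 \<le> bias D i \<and> i \<notin> output S r)} \<subseteq> ?G"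
      using output_correct by (force simp: space_pair_measure)
  qed
  also have "\<dots> = measure (iid_samples D) {S. \<not> good D S}"
    using ps sets_not_good by (rule measure_vimage_snd)
  also have "\<dots> < \<delta>" by (rule prob_not_good)
  finally show "M.prob {(r, S). \<exists>i\<in>{1..N}. (bias D i \<le> p\<^sub>0 \<and> i \<in> output S r) \<or> (q\<^sub>0 \<le> bias D i \<and> i \<notin> output S r)} < \<delta>" .
qed

section \<open>Cost bounds with explicit constants\<close>

lemma max_flips_le: "4 * phase_flips K + N * n\<^sub>0 \<le> 5 * phase_flips K"
proof -
  have p: "4 ^ K = 2 ^ K * (2::nat) ^ K" by (simp flip: power_mult_distrib)
  have "N \<le> 2 ^ K * 2 ^ K"
    using N_le_two_power_K mult_le_mono[of N "2 ^ K" 1 "2 ^ K"] by simp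
  then have "N * n\<^sub>0 \<le> 2 ^ K * 2 ^ K * n\<^sub>0" by (rule mult_le_mono1)
  then show ?thesis by (simp add: phase_flips_def p mult_ac)
qed

text \<open>Each of \<open>l\<close>, \<open>n\<^sub>0\<close>, \<open>K\<close> and 1 is at most
  \<open>n\<^sub>0 * N * 2 ^ K\<close>, and 73 = 4 + 2 + 6 + 61.\<close>

lemma running_time_le_flips: "running_time coin_program N start S r \<le> 40 * total_flips S r + 73 * (n\<^sub>0 * N * 2 ^ K)"
proof -
  let ?U = "n\<^sub>0 * N * 2 ^ K"
  have "n\<^sub>0 * 1 \<le> n\<^sub>0 * (N * 2 ^ K)" using N_ge_1 by (intro mult_le_mono2) simp
  then have 1: "n\<^sub>0 \<le> ?U" by (simp add: mult.assoc)
  have "1 * 2 ^ K \<le> (n\<^sub>0 * N) * 2 ^ K" using N_ge_1 n0_pos by (intro mult_le_mono1) simp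
  then have 2: "K < ?U" using less_exp[of K] by linarith
  have "1 \<le> ?U" using 1 n0_pos by linarith
  then show ?thesis using 1 2 l_le_n0 running_time_le[of S r] by linarith
qed

text \<open>Used for flips (\<open>a = 1\<close>, \<open>b = 0\<close>) and for time
  (\<open>a = 40\<close>, \<open>b = 73\<close>). Accurate samples are charged
  \<open>flips_bound\<close>, the others the worst case. Here 66 = 6 + 60, with 6 from
  \<open>integral_flips_bound_le\<close>.\<close>

lemma expected_cost:
  fixes f :: "samples \<Rightarrow> bits \<Rightarrow> nat"
  assumes f: "\<And>S r. f S r \<le> a * total_flips S r + b * (n\<^sub>0 * N * 2 ^ K)"
  shows "(\<integral>\<^sup>+ (r, S). of_nat (f S r) \<partial>(random_bits \<Otimes>\<^sub>M iid_samples D)) \<le>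
    ennreal (real (66 * a + b) * real (n\<^sub>0 * N * 2 ^ K))"
proof -
  let ?M = "random_bits \<Otimes>\<^sub>M iid_samples D"
  interpret R: prob_space random_bits by (rule prob_space_random_bits)
  interpret S: prob_space "iid_samples D" by (rule prob_space_iid_samples)
  let ?G = "{S. \<not> good D S}"
  define U where "U = n\<^sub>0 * N * 2 ^ K"
  define c where "c = real (a * (5 * phase_flips K))"
  have c: "c \<ge> 0" by (simp add: c_def)
  let ?g = "\<lambda>r. of_nat a * of_nat (flips_bound D r) + ennreal (real (b * U))"
  have le: "of_nat (f S r) \<le> ?g r + ennreal c * indicator ?G S" for r S
  proof -
    have "a * total_flips S r \<le> a * flips_bound D r + a * (5 * phase_flips K) * of_bool (\<not> good D S)"
      using total_flips_le_flips_bound[of D S r] total_flips_le[of S r] max_flips_le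
      by (cases "good D S") (auto intro!: mult_le_mono2 trans_le_add2)
    with f[of S r] have "f S r \<le> a * flips_bound D r + b * U + a * (5 * phase_flips K) * of_bool (\<not> good D S)"
      unfolding U_def by linarith
    then have "(of_nat (f S r) :: ennreal) \<le>
        of_nat (a * flips_bound D r + b * U + a * (5 * phase_flips K) * of_bool (\<not> good D S))"
      by (rule of_nat_mono)
    also have "\<dots> = ?g r + ennreal c * indicator ?G S"
      unfolding c_def ennreal_of_nat_eq_real_of_nat[symmetric] by (cases "good D S") simp_all
    finally show ?thesis .
  qed
  have [measurable]: "?G \<in> sets (iid_samples D)" by (rule sets_not_good)
  have "(\<integral>\<^sup>+ (r, S). of_nat (f S r) \<partial>?M) \<le> (\<integral>\<^sup>+ (r, S). ?g r + ennreal c * indicator ?G S \<partial>?M)"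
    using le by (intro nn_integral_mono) auto
  also have "\<dots> = (\<integral>\<^sup>+ r. \<integral>\<^sup>+ S. ?g r + ennreal c * indicator ?G S \<partial>iid_samples D \<partial>random_bits)"
    by (subst S.nn_integral_fst[symmetric]) auto
  also have "\<dots> = (\<integral>\<^sup>+ r. ?g r + ennreal c * S.prob ?G \<partial>random_bits)"
  proof (intro nn_integral_cong)
    fix r
    have "(\<integral>\<^sup>+ S. ?g r + ennreal c * indicator ?G S \<partial>iid_samples D) =
        (\<integral>\<^sup>+ S. ?g r \<partial>iid_samples D) + (\<integral>\<^sup>+ S. ennreal c * indicator ?G S \<partial>iid_samples D)"
      by (rule nn_integral_add) auto
    then show "(\<integral>\<^sup>+ S. ?g r + ennreal c * indicator ?G S \<partial>iid_samples D) = ?g r + ennreal c * S.prob ?G"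
      using sets_not_good[of D]
      by (simp add: nn_integral_cmult_indicator S.emeasure_eq_measure S.prob_space[simplified])
  qed
  also have "\<dots> = of_nat a * (\<integral>\<^sup>+ r. of_nat (flips_bound D r) \<partial>random_bits) + ennreal (real (b * U)) +
      ennreal c * S.prob ?G"
    by (simp add: nn_integral_add nn_integral_cmult R.emeasure_space_1[simplified])
  also have "\<dots> \<le> of_nat a * ennreal (6 * N * n\<^sub>0 * 2 ^ K) + ennreal (real (b * U)) + ennreal (60 * a * real U)"
  proof (intro add_mono mult_left_mono integral_flips_bound_le order_refl)
    have B: "real (phase_flips K) = n\<^sub>0 * 2 ^ K * 2 ^ K"
      by (simp add: phase_flips_def flip: power_mult_distrib)
    have "c * S.prob ?G \<le> c * \<delta>" using prob_not_good[of D] c by (intro mult_left_mono) auto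
    also have "\<dots> = 5 * real a * n\<^sub>0 * 2 ^ K * (\<delta> * 2 ^ K)" by (simp add: c_def B)
    \<comment> \<open>The worst case exceeds the target by a factor of order
      \<open>2 ^ K / N\<close>, which the failure probability below \<open>\<delta>\<close>
      compensates.\<close>
    also have "\<dots> \<le> 5 * real a * n\<^sub>0 * 2 ^ K * (12 * N)" using two_power_K(3) by (intro mult_left_mono) auto
    also have "\<dots> = 60 * a * real U" by (simp add: U_def)
    finally have "ennreal (c * S.prob ?G) \<le> ennreal (60 * a * real U)" by (rule ennreal_leI)
    then show "ennreal c * S.prob ?G \<le> ennreal (60 * a * real U)"
      using c by (simp add: ennreal_mult)
  qed simp
  also have "of_nat a * ennreal (6 * N * n\<^sub>0 * 2 ^ K) = ennreal (6 * a * real U)"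
    unfolding ennreal_of_nat_eq_real_of_nat
    by (subst ennreal_mult[symmetric]) (auto simp: U_def mult_ac intro!: arg_cong[where f = ennreal])
  also have "ennreal (6 * a * real U) + ennreal (real (b * U)) + ennreal (60 * a * real U) =
      ennreal (real (66 * a + b) * real U)"
    by (simp add: algebra_simps flip: ennreal_plus)
  finally show ?thesis unfolding U_def .
qed

text \<open>As N / \<delta> \<ge> 2, the logarithm is at least 2/3, so the factor 4 absorbs the
  rounding up in \<open>l\<close>.\<close>

lemma l_le: "real l \<le> 4 * ln (N / \<delta>)"
proof -
  have "2 ^ (l - 1) < real N / \<delta>" using l_iff[of "l - 1"] l_pos by simp
  then have "ln (2 ^ (l - 1)) < ln (N / \<delta>)" using params N_ge_1 by (intro ln_less_cancel_iff[THEN iffD2]) auto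
  then have "real (l - 1) * ln 2 < ln (N / \<delta>)" by (simp add: ln_realpow)
  moreover have "real (l - 1) * (2 / 3) \<le> real (l - 1) * ln 2"
    using ln2_ge_two_thirds by (intro mult_left_mono) auto
  ultimately have 1: "(real l - 1) * (2 / 3) < ln (N / \<delta>)" using l_pos by (simp add: of_nat_diff)
  have "2 \<le> real N / \<delta>" using params N_ge_1 by (simp add: le_divide_eq)
  then have "ln 2 \<le> ln (N / \<delta>)" by simp
  then have "2 / 3 \<le> ln (N / \<delta>)" using ln2_ge_two_thirds by linarith
  with 1 show ?thesis by simp
qed

text \<open>Rounding up adds at most 1 \<le> \<open>?x\<close>, and 4100 = 1025 * 4 with the 4 from
  \<open>l_le\<close>.\<close>

lemma n0_upper: "n\<^sub>0 \<le> 4100 * (q\<^sub>0 * ln (N / \<delta>) / (q\<^sub>0 - p\<^sub>0)\<^sup>2)"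
proof -
  let ?x = "q\<^sub>0 * real l / (q\<^sub>0 - p\<^sub>0)\<^sup>2"
  have e: "(q\<^sub>0 - p\<^sub>0)\<^sup>2 > 0" using params by simp
  have "real (n\<^sub>0 - 1) < 1024 * ?x"
    using n0_iff[of "n\<^sub>0 - 1"] n0_pos by (simp add: power2_eq_square)
  moreover have "1 \<le> ?x"
  proof -
    have "(q\<^sub>0 - p\<^sub>0)\<^sup>2 \<le> q\<^sub>0 * 1"
      unfolding power2_eq_square using params by (intro mult_mono) auto
    also have "\<dots> \<le> q\<^sub>0 * real l" using l_pos params by (intro mult_left_mono) auto
    finally show ?thesis using e by simp
  qed
  ultimately have "real n\<^sub>0 \<le> 1025 * ?x" using n0_pos by (simp add: of_nat_diff)
  also have "\<dots> \<le> 1025 * (q\<^sub>0 * (4 * ln (N / \<delta>)) / (q\<^sub>0 - p\<^sub>0)\<^sup>2)"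
    using l_le e params by (intro mult_left_mono divide_right_mono) auto
  finally show ?thesis by simp
qed

lemma two_power_K_le: "2 ^ K \<le> 48 * N / \<rho>"
  using two_power_K(2) params by (simp add: field_simps)

text \<open>196800 = 4100 * 48; in \<open>worst_unit_le\<close> a second factor 48 from
  \<open>2 ^ K\<close> gives 9446400.\<close>

lemma expected_unit_le:
  "real (n\<^sub>0 * N * 2 ^ K) \<le> 196800 * ((real N)\<^sup>2 * q\<^sub>0 * ln (N / \<delta>) / ((q\<^sub>0 - p\<^sub>0)\<^sup>2 * \<rho>))"
proof -
  let ?y = "4100 * (q\<^sub>0 * ln (N / \<delta>) / (q\<^sub>0 - p\<^sub>0)\<^sup>2)"
  have "real n\<^sub>0 * 2 ^ K \<le> ?y * (48 * N / \<rho>)"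
    using n0_upper two_power_K_le by (intro mult_mono) (auto intro: order_trans[OF of_nat_0_le_iff])
  then have "(real n\<^sub>0 * 2 ^ K) * N \<le> (?y * (48 * N / \<rho>)) * N" by (rule mult_right_mono) simp
  then show ?thesis by (simp add: power2_eq_square field_simps)
qed

lemma worst_unit_le:
  "real (phase_flips K) \<le> 9446400 * ((real N)\<^sup>2 * q\<^sub>0 * ln (N / \<delta>) / ((q\<^sub>0 - p\<^sub>0)\<^sup>2 * \<rho>\<^sup>2))"
proof -
  let ?y = "4100 * (q\<^sub>0 * ln (N / \<delta>) / (q\<^sub>0 - p\<^sub>0)\<^sup>2)"
  have B: "real (phase_flips K) = n\<^sub>0 * (2 ^ K * 2 ^ K)"
    by (simp add: phase_flips_def flip: power_mult_distrib)
  have "real n\<^sub>0 * (2 ^ K * 2 ^ K) \<le> ?y * ((48 * N / \<rho>) * (48 * N / \<rho>))"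
    using n0_upper two_power_K_le params
    by (intro mult_mono) (auto intro: order_trans[OF of_nat_0_le_iff])
  then show ?thesis unfolding B by (simp add: power2_eq_square field_simps)
qed

lemma costs:
  fixes E W C :: real
  defines "E \<equiv> (real N)\<^sup>2 * q\<^sub>0 * ln (real N / \<delta>) / ((q\<^sub>0 - p\<^sub>0)\<^sup>2 * \<rho>)"
    and "W \<equiv> (real N)\<^sup>2 * q\<^sub>0 * ln (real N / \<delta>) / ((q\<^sub>0 - p\<^sub>0)\<^sup>2 * \<rho>\<^sup>2)"
    and "C \<equiv> 10 ^ 10"
  shows "expected_cost_le total_flips (C * E)"
    "expected_cost_le (running_time coin_program N start) (C * E)"
    "worst_case_cost_le total_flips (C * W)"
    "worst_case_cost_le (running_time coin_program N start) (C * W)"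
proof -
  let ?U = "n\<^sub>0 * N * 2 ^ K"
  have U: "real ?U \<le> 196800 * E" unfolding E_def by (rule expected_unit_le)
  have V: "real (phase_flips K) \<le> 9446400 * W" unfolding W_def by (rule worst_unit_le)
  \<comment> \<open>The largest need is 273 * 9446400 for the worst-case time, where 273 = 40 * 5 +
    73.\<close>
  have C: "C = 10000000000" by (simp add: C_def)
  have E0: "0 \<le> E" using U of_nat_0_le_iff[of ?U] by linarith
  have W0: "0 \<le> W" using V of_nat_0_le_iff[of "phase_flips K"] by linarith
  have "(\<integral>\<^sup>+ (r, S). of_nat (total_flips S r) \<partial>(random_bits \<Otimes>\<^sub>M iid_samples D)) \<le> ennreal (C * E)" for D
  proof -
    have "(\<integral>\<^sup>+ (r, S). of_nat (total_flips S r) \<partial>(random_bits \<Otimes>\<^sub>M iid_samples D)) \<le>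
        ennreal (real (66 * 1 + 0) * real ?U)"
      by (rule expected_cost) simp
    also have "\<dots> \<le> ennreal (C * E)"
      using U E0 by (intro ennreal_leI) (simp add: C_def del: of_nat_mult)
    finally show ?thesis .
  qed
  then show "expected_cost_le total_flips (C * E)" unfolding expected_cost_le_def by simp
  have "(\<integral>\<^sup>+ (r, S). of_nat (running_time coin_program N start S r) \<partial>(random_bits \<Otimes>\<^sub>M iid_samples D))
      \<le> ennreal (C * E)" for D
  proof -
    have "(\<integral>\<^sup>+ (r, S). of_nat (running_time coin_program N start S r) \<partial>(random_bits \<Otimes>\<^sub>M iid_samples D)) \<le>
        ennreal (real (66 * 40 + 73) * real ?U)"
      by (rule expected_cost) (rule running_time_le_flips)
    also have "\<dots> \<le> ennreal (C * E)"
      using U E0 by (intro ennreal_leI) (simp add: C_def del: of_nat_mult)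
    finally show ?thesis .
  qed
  then show "expected_cost_le (running_time coin_program N start) (C * E)"
    unfolding expected_cost_le_def by simp
  have t: "total_flips S r \<le> 5 * phase_flips K" for S r
    using total_flips_le[of S r] max_flips_le by linarith
  show "worst_case_cost_le total_flips (C * W)"
    unfolding worst_case_cost_le_def
  proof (intro allI)
    fix S r
    have "real (total_flips S r) \<le> 5 * real (phase_flips K)" using t[of S r] by linarith
    then show "real (total_flips S r) \<le> C * W" using V W0 unfolding C by linarith
  qed
  show "worst_case_cost_le (running_time coin_program N start) (C * W)"
    unfolding worst_case_cost_le_def
  proof (intro allI)
    fix S r
    have "?U \<le> n\<^sub>0 * (2 ^ K * 2 ^ K)"
      using N_le_two_power_K by (simp add: mult.assoc)
    also have "\<dots> = phase_flips K" by (simp add: phase_flips_def flip: power_mult_distrib)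
    finally have "running_time coin_program N start S r \<le> 273 * phase_flips K"
      using t[of S r] running_time_le_flips[of S r] by linarith
    then have "real (running_time coin_program N start S r) \<le> 273 * real (phase_flips K)" by linarith
    then show "real (running_time coin_program N start S r) \<le> C * W"
      using V W0 unfolding C by linarith
  qed
qed

end

section \<open>Choice of the parameters and conclusion\<close>

lemma obtain_crossing:
  fixes f :: "nat \<Rightarrow> real"
  assumes "mono f" "X \<le> f m"
  obtains l where "\<And>j. f j < X \<longleftrightarrow> j < l"
proof
  \<comment> \<open>Monotonicity makes the first index at which \<open>f\<close> reaches
    \<open>X\<close> a sharp cut, the form in which the loop tests use it.\<close>
  let ?l = "LEAST j. X \<le> f j"
  show "f j < X \<longleftrightarrow> j < ?l" for j
  proof
    assume "f j < X"
    moreover have "X \<le> f ?l" using assms(2) by (rule LeastI)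
    ultimately show "j < ?l" using monoD[OF assms(1), of ?l j] by (cases "?l \<le> j") auto
  next
    assume "j < ?l"
    then show "f j < X" using not_less_Least[of j "\<lambda>j. X \<le> f j"] by simp
  qed
qed

theorem theorem6p1:
  "\<exists>(P :: program) (C :: real). C > 0 \<and>
     (\<forall>(N :: nat) (p\<^sub>0 :: real) (q\<^sub>0 :: real) (\<delta> :: real) (\<rho> :: real).
        N \<ge> 1 \<and> 0 \<le> p\<^sub>0 \<and> p\<^sub>0 < q\<^sub>0 \<and> q\<^sub>0 \<le> 1 \<and> 0 < \<delta> \<and> 4 * \<delta> < \<rho> \<and> \<rho> < 1 / 2 \<longrightarrow>
        (let s = initial_state N p\<^sub>0 q\<^sub>0 \<delta> \<rho>;
             E = (real N)\<^sup>2 * q\<^sub>0 * ln (real N / \<delta>) / ((q\<^sub>0 - p\<^sub>0)\<^sup>2 * \<rho>);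
             W = (real N)\<^sup>2 * q\<^sub>0 * ln (real N / \<delta>) / ((q\<^sub>0 - p\<^sub>0)\<^sup>2 * \<rho>\<^sup>2)
         in always_halts P N s \<and>
            replicable \<rho> (coin_output P N s) \<and>
            solves_coin_problem N p\<^sub>0 q\<^sub>0 \<delta> (coin_output P N s) \<and>
            expected_cost_le (coordinate_samples P N s) (C * E) \<and>
            expected_cost_le (running_time P N s) (C * E) \<and>
            worst_case_cost_le (coordinate_samples P N s) (C * W) \<and>
            worst_case_cost_le (running_time P N s) (C * W)))"
proof (intro exI[of _ coin_program] exI[of _ "10 ^ 10"] conjI allI impI)
  fix N :: nat and p\<^sub>0 q\<^sub>0 \<delta> \<rho> :: real
  assume *: "N \<ge> 1 \<and> 0 \<le> p\<^sub>0 \<and> p\<^sub>0 < q\<^sub>0 \<and> q\<^sub>0 \<le> 1 \<and> 0 < \<delta> \<and> 4 * \<delta> < \<rho> \<and> \<rho> < 1 / 2"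
  have pow: "mono (\<lambda>j. (2::real) ^ j)" by (intro monoI power_increasing) auto
  obtain m where "real N / \<delta> < 2 ^ m" using real_arch_pow[of 2] by auto
  then obtain l where l: "\<And>j. 2 ^ j < real N / \<delta> \<longleftrightarrow> j < l"
    using obtain_crossing[OF pow] by (metis less_imp_le)
  obtain m where "24 * real N / \<rho> < 2 ^ m" using real_arch_pow[of 2] by auto
  then obtain K where K: "\<And>j. 2 ^ j < 24 * real N / \<rho> \<longleftrightarrow> j < K"
    using obtain_crossing[OF pow] by (metis less_imp_le)
  \<comment> \<open>This comes after \<open>l\<close>, on which the target for the first phase
    depends.\<close>
  obtain m where "1024 * q\<^sub>0 * real l / (q\<^sub>0 - p\<^sub>0) / (q\<^sub>0 - p\<^sub>0) \<le> real m" using real_arch_simple by blast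
  then obtain n\<^sub>0 where n0: "\<And>j. real j < 1024 * q\<^sub>0 * real l / (q\<^sub>0 - p\<^sub>0) / (q\<^sub>0 - p\<^sub>0) \<longleftrightarrow> j < n\<^sub>0"
    using obtain_crossing[of real] by (metis (no_types, lifting) monoI of_nat_mono)
  interpret coin_parameters N p\<^sub>0 q\<^sub>0 \<delta> \<rho> l n\<^sub>0 K
    using * l K n0 by unfold_locales auto
  show "let s = initial_state N p\<^sub>0 q\<^sub>0 \<delta> \<rho>;
             E = (real N)\<^sup>2 * q\<^sub>0 * ln (real N / \<delta>) / ((q\<^sub>0 - p\<^sub>0)\<^sup>2 * \<rho>);
             W = (real N)\<^sup>2 * q\<^sub>0 * ln (real N / \<delta>) / ((q\<^sub>0 - p\<^sub>0)\<^sup>2 * \<rho>\<^sup>2)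
         in always_halts coin_program N s \<and>
            replicable \<rho> (coin_output coin_program N s) \<and>
            solves_coin_problem N p\<^sub>0 q\<^sub>0 \<delta> (coin_output coin_program N s) \<and>
            expected_cost_le (coordinate_samples coin_program N s) (10 ^ 10 * E) \<and>
            expected_cost_le (running_time coin_program N s) (10 ^ 10 * E) \<and>
            worst_case_cost_le (coordinate_samples coin_program N s) (10 ^ 10 * W) \<and>
            worst_case_cost_le (running_time coin_program N s) (10 ^ 10 * W)"
    unfolding Let_def
    using always_halts replicable_output solves_output costs by blast
qed simp

end
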